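(* Let $K$ be a field of characteristic zero, let $m,n\ge 1$ be integers, and let $\Sigma\subset K_{m,n}$ be a system of homogeneous linear differential equations of differential type zero. Let $\mathcal T(\mathrm{Sol}(\Sigma))\subset (2^{\mathbb N^m})^n$ be the set of supports of $\mathrm{Sol}(\Sigma)$. Then: (1) The set $\mathcal C(\mathrm{Sol}(\Sigma))$ of minimal non-empty elements of $\mathcal T(\mathrm{Sol}(\Sigma))$ (for the product order) defines the circuits of a matroid $M(\mathrm{Sol}(\Sigma))$ on $[n]\times\mathbb N^m$; that is, $\phi(\mathcal C(\mathrm{Sol}(\Sigma)))\subset 2^{[n]\times\mathbb N^m}$ is the set of circuits of a matroid on $[n]\times\mathbb N^m$. (2) If $\#([n]\times\mathbb N^m)<\#K$, then $\phi(\mathcal T(\mathrm{Sol}(\Sigma)))\subset 2^{[n]\times\mathbb N^m}$ is the set of scrawls of the matroid $M(\mathrm{Sol}(\Sigma))$.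
   Context: Notation: $\mathbb N=\{0,1,2,\dots\}$, $[n]=\{1,\dots,n\}$, $2^E$ is the power set of $E$, $\#$ denotes cardinality. Differential algebra. $K[[T]]=K[[t_1,\dots,t_m]]$. For $J=(j_1,\dots,j_m)\in\mathbb N^m$ let $\Theta(J)=\partial^{|J|}/\partial t_1^{j_1}\cdots\partial t_m^{j_m}$. $K_{m,n}$ is the polynomial ring $K[[T]][x_{i,J}: 1\le i\le n,\ J\in\mathbb N^m]$, where $x_{i,J}=\Theta(J)x_i$ are the derivatives of differential indeterminates $x_1,\dots,x_n$. A homogeneous linear differential equation is an element $P=\sum_{i,J}\alpha_{i,J}x_{i,J}$ (finite sum, $\alpha_{i,J}\in K[[T]]$). A vector $\varphi\in K[[T]]^n$ is a solution of $P\in K_{m,n}$ if $P$ becomes $0$ after substituting $x_{i,J}\mapsto\Theta(J)\varphi_i$; $\mathrm{Sol}(\Sigma)\subset K[[T]]^n$ is the set of common solutions of all $P\in\Sigma$. Differential type zero. Regard $\Sigma$ as having coefficients in $F=\mathrm{Frac}(K[[T]])$, fix a ranking on the $x_{i,J}$ (a well-ordering compatible with derivation), let $\Omega$ be an autoreduced (characteristic) set of the differential ideal generated by $\Sigma$, let $L$ be the set of leaders (highest ranked variables) of the elements of $\Omega$, and $\Theta L$ the set of all derivatives of elements of $L$. Let $d=\#(\{x_{i,J}\}\setminus\Theta L)$; this is the transcendence degree of the general solution of $\Sigma$ (for homogeneous linear $\Sigma$: the $F$-dimension of $\bigoplus_{i,J}F x_{i,J}$ modulo the $F$-span of all derivatives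 $\Theta(J)P$, $P\in\Sigma$, $J\in\mathbb N^m$). $\Sigma$ is of differential type zero iff $d$ is finite. Supports. For $w=\sum_J a_Jt^J\in K[[T]]$, $\mathcal T(w)=\{J: a_J\ne0\}\in 2^{\mathbb N^m}$. For $X\subset K[[T]]^n$, $\mathcal T(X)=\{(\mathcal T(w_1),\dots,\mathcal T(w_n)):(w_1,\dots,w_n)\in X\}\subset(2^{\mathbb N^m})^n$. The product order on $(2^{\mathbb N^m})^n$ is $(S_i)\le(T_i)$ iff $S_i\subseteq T_i$ for all $i$; "non-empty" means different from $(\emptyset,\dots,\emptyset)$. The bijection $\phi:(2^{\mathbb N^m})^n\to 2^{[n]\times\mathbb N^m}$ is $\phi(S_1,\dots,S_n)=\{1\}\times S_1\cup\dots\cup\{n\}\times S_n$. Matroids (possibly infinite). $\mathcal C\subset 2^E$ is the set of circuits of a matroid on $E$ if: (i) $\emptyset\notin\mathcal C$; (ii) no element of $\mathcal C$ is a proper subset of another; (iii) whenever $X\subset C\in\mathcal C$ and $\{C_x: x\in X\}$ is a family in $\mathcal C$ with $x\in C_y\iff x=y$ for all $x,y\in X$, then for every $z\in C\setminus\bigcup_xC_x$ there is $C'\in\mathcal C$ with $z\in C'\subset (C\cup\bigcup_xC_x)\setminus X$; (iv) with $\mathcal I=\{I\subset E: C\not\subset I\ \forall C\in\mathcal C\}$, whenever $I\subset X\subset E$ and $I\in\mathcal I$, the set $\{I'\in\mathcal I: I\subset I'\subset X\}$ has a maximal element with respect to inclusion. The scrawls of a matroid are the unions of (arbitrary families of) its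 circuits, including the empty union $\emptyset$. *)

theory Defs
  imports
    "HOL-Analysis.Finite_Cartesian_Product"
    "HOL-Library.Poly_Mapping"
    "HOL-Library.Equipollence"
    "HOL-Computational_Algebra.Fraction_Field"
begin

section \<open>The ring of formal power series in several variables\<close>

text \<open>
  The number of variables is the cardinality of the index type \<open>'m\<close>; exponents \<open>J \<in> \<nat>\<^sup>m\<close>
  are vectors of type \<open>nat ^ 'm\<close>, and \<open>('k, 'm) mfps\<close> is the ring \<open>K[[t\<^sub>1, \<dots>, t\<^sub>m]]\<close>.
\<close>

typedef ('k, 'm::finite) mfps = "UNIV :: (nat ^ 'm \<Rightarrow> 'k) set"
  morphisms mfps_nth Abs_mfps
  by simp

setup_lifting type_definition_mfps

lemma mfps_eqI: "(\<And>J. mfps_nth f J = mfps_nth g J) \<Longrightarrow> f = g"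
  by transfer auto

definition splits :: "nat ^ 'm \<Rightarrow> ((nat ^ 'm) \<times> (nat ^ 'm::finite)) set" where
  "splits J = {(A, B). A + B = J}"

lemma finite_splits [simp]: "finite (splits J)"
proof -
  let ?D = "{A :: nat ^ 'a. \<forall>i. A $ i \<le> J $ i}"
  have "?D \<subseteq> vec_lambda ` (Pi UNIV (\<lambda>i. {..J $ i}))"
  proof
    fix A assume "A \<in> ?D"
    then have "vec_nth A \<in> Pi UNIV (\<lambda>i. {..J $ i})" by auto
    then show "A \<in> vec_lambda ` (Pi UNIV (\<lambda>i. {..J $ i}))"
      by (metis image_eqI vec_nth_inverse)
  qed
  moreover have "finite (Pi UNIV (\<lambda>i. {..J $ i}))"
    using finite_PiE[of "UNIV :: 'a set" "\<lambda>i. {..J $ i}"] by (simp add: PiE_def)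
  ultimately have "finite ?D" by (meson finite_imageI finite_subset)
  moreover have "splits J \<subseteq> ?D \<times> ?D" by (auto simp: splits_def)
  ultimately show ?thesis by (meson finite_SigmaI finite_subset)
qed

instantiation mfps :: (comm_ring_1, finite) comm_ring_1
begin

lift_definition zero_mfps :: "('a, 'b) mfps" is "\<lambda>_. 0" .
lift_definition one_mfps :: "('a, 'b) mfps" is "\<lambda>J. if J = 0 then 1 else 0" .
lift_definition plus_mfps :: "('a, 'b) mfps \<Rightarrow> ('a, 'b) mfps \<Rightarrow> ('a, 'b) mfps"
  is "\<lambda>f g J. f J + g J" .
lift_definition minus_mfps :: "('a, 'b) mfps \<Rightarrow> ('a, 'b) mfps \<Rightarrow> ('a, 'b) mfps"
  is "\<lambda>f g J. f J - g J" .
lift_definition uminus_mfps :: "('a, 'b) mfps \<Rightarrow> ('a, 'b) mfps"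
  is "\<lambda>f J. - f J" .
lift_definition times_mfps :: "('a, 'b) mfps \<Rightarrow> ('a, 'b) mfps \<Rightarrow> ('a, 'b) mfps"
  is "\<lambda>f g J. \<Sum>(A, B)\<in>splits J. f A * g B" .

instance
proof
  fix f g h :: "('a, 'b) mfps"
  show "f + g + h = f + (g + h)" "f + g = g + f" "0 + f = f" "- f + f = 0" "f - g = f + - g"
    by (transfer, simp add: algebra_simps fun_eq_iff)+
  show "(f + g) * h = f * h + g * h"
    by transfer (simp add: algebra_simps fun_eq_iff sum.distrib case_prod_unfold)
  show "(0 :: ('a, 'b) mfps) \<noteq> 1"
    by transfer (metis zero_neq_one)
  show "f * g = g * f"
  proof transfer
    fix f g :: "nat ^ 'b \<Rightarrow> 'a"
    have "(\<Sum>(A, B)\<in>splits J. f A * g B) = (\<Sum>(A, B)\<in>splits J. g A * f B)" for J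
      by (rule sum.reindex_bij_witness[where i = prod.swap and j = prod.swap])
        (auto simp: splits_def algebra_simps)
    then show "(\<lambda>J. \<Sum>(A, B)\<in>splits J. f A * g B) = (\<lambda>J. \<Sum>(A, B)\<in>splits J. g A * f B)"
      by blast
  qed
  show "1 * f = f"
  proof transfer
    fix f :: "nat ^ 'b \<Rightarrow> 'a"
    have "(\<Sum>(A, B)\<in>splits J. (if A = 0 then 1 else 0) * f B) = f J" for J
    proof -
      have "(\<Sum>(A, B)\<in>splits J. (if A = 0 then 1 else 0) * f B)
          = (\<Sum>p\<in>{(0 :: nat ^ 'b, J)}. (if fst p = 0 then 1 else 0) * f (snd p))"
        unfolding case_prod_unfold
        by (rule sum.mono_neutral_right[OF finite_splits]) (auto simp: splits_def)
      then show ?thesis by simp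
    qed
    then show "(\<lambda>J. \<Sum>(A, B)\<in>splits J. (if A = 0 then 1 else 0) * f B) = f"
      by blast
  qed
  show "f * g * h = f * (g * h)"
  proof transfer
    fix f g h :: "nat ^ 'b \<Rightarrow> 'a"
    have "(\<Sum>(D, C)\<in>splits J. (\<Sum>(A, B)\<in>splits D. f A * g B) * h C)
        = (\<Sum>(A, D)\<in>splits J. f A * (\<Sum>(B, C)\<in>splits D. g B * h C))" for J
    proof -
      have "(\<Sum>(D, C)\<in>splits J. (\<Sum>(A, B)\<in>splits D. f A * g B) * h C)
          = (\<Sum>p\<in>splits J. \<Sum>q\<in>splits (fst p). f (fst q) * g (snd q) * h (snd p))"
        by (simp add: case_prod_unfold sum_distrib_right)
      also have "\<dots> = (\<Sum>(p, q)\<in>(SIGMA p:splits J. splits (fst p)).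
          f (fst q) * g (snd q) * h (snd p))"
        by (rule sum.Sigma) auto
      also have "\<dots> = (\<Sum>(p, q)\<in>(SIGMA p:splits J. splits (snd p)).
          f (fst p) * (g (fst q) * h (snd q)))"
        by (rule sum.reindex_bij_witness
            [where j = "\<lambda>((D, C), (A, B)). ((A, B + C), (B, C))"
               and i = "\<lambda>((A, D), (B, C)). ((A + B, C), (A, B))"])
          (auto simp: splits_def algebra_simps)
      also have "\<dots> = (\<Sum>p\<in>splits J. \<Sum>q\<in>splits (snd p). f (fst p) * (g (fst q) * h (snd q)))"
        by (rule sum.Sigma[symmetric]) auto
      finally show ?thesis
        by (simp add: case_prod_unfold sum_distrib_left)
    qed
    then show "(\<lambda>J. \<Sum>(D, C)\<in>splits J. (\<Sum>(A, B)\<in>splits D. f A * g B) * h C)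
        = (\<lambda>J. \<Sum>(A, D)\<in>splits J. f A * (\<Sum>(B, C)\<in>splits D. g B * h C))"
      by blast
  qed
qed

end

lemma unique_extremal_sum:
  fixes S T :: "(nat ^ 'm::finite) set"
  assumes "S \<noteq> {}" "T \<noteq> {}"
  obtains A B where "A \<in> S" "B \<in> T"
    "\<And>A' B'. A' \<in> S \<Longrightarrow> B' \<in> T \<Longrightarrow> A' + B' = A + B \<Longrightarrow> A' = A \<and> B' = B"
proof -
  define Q where "Q U S' T' \<longleftrightarrow> S' \<subseteq> S \<and> T' \<subseteq> T \<and> S' \<noteq> {} \<and> T' \<noteq> {} \<and>
      (\<forall>k\<in>U. (\<forall>A\<in>S'. \<forall>A'\<in>S'. A $ k = A' $ k) \<and> (\<forall>B\<in>T'. \<forall>B'\<in>T'. B $ k = B' $ k)) \<and>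
      (\<forall>A\<in>S'. \<forall>B\<in>T'. \<forall>A'\<in>S. \<forall>B'\<in>T. A' + B' = A + B \<longrightarrow> A' \<in> S' \<and> B' \<in> T')"
    for U :: "'m set" and S' T'
  note QD = Q_def[THEN iffD1]
  have "\<exists>S' T'. Q U S' T'" if "finite U" for U :: "'m set"
    using that
  proof (induction U)
    case empty
    have "Q {} S T" using assms by (simp add: Q_def)
    then show ?case by blast
  next
    case (insert k U)
    then obtain S' T' where Q: "Q U S' T'" by blast
    note * = QD[OF Q, THEN conjunct1]
      QD[OF Q, THEN conjunct2, THEN conjunct1]
      QD[OF Q, THEN conjunct2, THEN conjunct2, THEN conjunct1]
      QD[OF Q, THEN conjunct2, THEN conjunct2, THEN conjunct2, THEN conjunct1]
      QD[OF Q, THEN conjunct2, THEN conjunct2, THEN conjunct2, THEN conjunct2, THEN conjunct1]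
      QD[OF Q, THEN conjunct2, THEN conjunct2, THEN conjunct2, THEN conjunct2, THEN conjunct2]
    from *(3,4) obtain A0 B0 where "A0 \<in> S'" "B0 \<in> T'" by blast
    then obtain A1 B1 where A1: "A1 \<in> S'" "\<And>A. A \<in> S' \<Longrightarrow> A1 $ k \<le> A $ k"
      and B1: "B1 \<in> T'" "\<And>B. B \<in> T' \<Longrightarrow> B1 $ k \<le> B $ k"
      using ex_has_least_nat[of "\<lambda>A. A \<in> S'" A0 "\<lambda>A. A $ k"]
        ex_has_least_nat[of "\<lambda>B. B \<in> T'" B0 "\<lambda>B. B $ k"] by auto
    define S'' where "S'' = {A \<in> S'. A $ k = A1 $ k}"
    define T'' where "T'' = {B \<in> T'. B $ k = B1 $ k}"
    have sub: "S'' \<subseteq> S'" "T'' \<subseteq> T'" by (auto simp: S''_def T''_def)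
    have ne: "S'' \<noteq> {}" "T'' \<noteq> {}" using A1(1) B1(1) by (auto simp: S''_def T''_def)
    have const: "(\<forall>A\<in>S''. \<forall>A'\<in>S''. A $ l = A' $ l) \<and> (\<forall>B\<in>T''. \<forall>B'\<in>T''. B $ l = B' $ l)"
      if "l \<in> insert k U" for l
    proof (cases "l = k")
      case True
      then show ?thesis by (simp add: S''_def T''_def)
    next
      case False
      with that *(5) sub show ?thesis by blast
    qed
    have ext: "A' \<in> S'' \<and> B' \<in> T''"
      if "A \<in> S''" "B \<in> T''" "A' \<in> S" "B' \<in> T" "A' + B' = A + B" for A B A' B'
    proof -
      have mem: "A' \<in> S'" "B' \<in> T'" using that sub *(6) by blast+
      have "A' $ k + B' $ k = A $ k + B $ k"
        using that(5) by (metis vector_add_component)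
      with that(1,2) have "A' $ k + B' $ k = A1 $ k + B1 $ k" by (simp add: S''_def T''_def)
      with mem A1(2)[of A'] B1(2)[of B'] show ?thesis by (simp add: S''_def T''_def)
    qed
    have "Q (insert k U) S'' T''"
      unfolding Q_def
    proof (intro conjI ballI impI)
      show "S'' \<subseteq> S" using sub(1) *(1) by (rule order_trans)
      show "T'' \<subseteq> T" using sub(2) *(2) by (rule order_trans)
      show "S'' \<noteq> {}" "T'' \<noteq> {}" by (rule ne)+
    next
      fix l A A' assume "l \<in> insert k U" "A \<in> S''" "A' \<in> S''"
      then show "A $ l = A' $ l" using const by blast
    next
      fix l B B' assume "l \<in> insert k U" "B \<in> T''" "B' \<in> T''"
      then show "B $ l = B' $ l" using const by blast
    next
      fix A B A' B' assume "A \<in> S''" "B \<in> T''" "A' \<in> S" "B' \<in> T" "A' + B' = A + B"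
      from ext[OF this] show "A' \<in> S''" "B' \<in> T''" by simp_all
    qed
    then show ?case by blast
  qed
  from this[OF finite, of UNIV] obtain S' T' where Q: "Q UNIV S' T'" by blast
  note * = QD[OF Q, THEN conjunct1]
    QD[OF Q, THEN conjunct2, THEN conjunct1]
    QD[OF Q, THEN conjunct2, THEN conjunct2, THEN conjunct1]
    QD[OF Q, THEN conjunct2, THEN conjunct2, THEN conjunct2, THEN conjunct1]
    QD[OF Q, THEN conjunct2, THEN conjunct2, THEN conjunct2, THEN conjunct2, THEN conjunct1]
    QD[OF Q, THEN conjunct2, THEN conjunct2, THEN conjunct2, THEN conjunct2, THEN conjunct2]
  from *(3,4) obtain A B where AB: "A \<in> S'" "B \<in> T'" by blast
  have S': "A' = A" if "A' \<in> S'" for A'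
    unfolding vec_eq_iff using *(5) AB that by blast
  have T': "B' = B" if "B' \<in> T'" for B'
    unfolding vec_eq_iff using *(5) AB that by blast
  show ?thesis
  proof (rule that[of A B])
    show "A \<in> S" "B \<in> T" using AB *(1,2) by blast+
    fix A' B' assume "A' \<in> S" "B' \<in> T" "A' + B' = A + B"
    with *(6) AB have "A' \<in> S'" "B' \<in> T'" by blast+
    with S' T' show "A' = A \<and> B' = B" by simp
  qed
qed

instance mfps :: (idom, finite) idom
proof
  fix f g :: "('a, 'b) mfps"
  assume "f \<noteq> 0" "g \<noteq> 0"
  then have "{J. mfps_nth f J \<noteq> 0} \<noteq> {}" "{J. mfps_nth g J \<noteq> 0} \<noteq> {}"
    by (transfer, auto)+
  then obtain A B where AB: "mfps_nth f A \<noteq> 0" "mfps_nth g B \<noteq> 0"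
    "\<And>A' B'. mfps_nth f A' \<noteq> 0 \<Longrightarrow> mfps_nth g B' \<noteq> 0 \<Longrightarrow> A' + B' = A + B \<Longrightarrow> A' = A \<and> B' = B"
    by (rule unique_extremal_sum) auto
  have "mfps_nth (f * g) (A + B)
      = (\<Sum>p\<in>splits (A + B). mfps_nth f (fst p) * mfps_nth g (snd p))"
    by (simp add: times_mfps.rep_eq case_prod_unfold)
  also have "\<dots> = (\<Sum>p\<in>{(A, B)}. mfps_nth f (fst p) * mfps_nth g (snd p))"
    using AB(3) by (intro sum.mono_neutral_right[OF finite_splits]) (auto simp: splits_def)
  also have "\<dots> \<noteq> 0" using AB by simp
  finally show "f * g \<noteq> 0" by (metis zero_mfps.rep_eq)
qed


section \<open>Derivatives of power series\<close>

definition mfps_pd :: "'m \<Rightarrow> ('k::field_char_0, 'm::finite) mfps \<Rightarrow> ('k, 'm) mfps" where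
  "mfps_pd k f = Abs_mfps (\<lambda>J. of_nat (J $ k + 1) * mfps_nth f (J + axis k 1))"

text \<open>
  The operator \<open>\<Theta>(J)\<close>, coefficientwise: in each variable, the \<open>j\<close>-th derivative of
  \<open>t ^ (i + j)\<close> is \<open>((i + j)! / i!) t ^ i\<close>. It is the iterated partial derivative by
  \<open>Theta_0\<close> and \<open>Theta_add_axis\<close> below.
\<close>

definition Theta :: "nat ^ 'm \<Rightarrow> ('k::field_char_0, 'm::finite) mfps \<Rightarrow> ('k, 'm) mfps" where
  "Theta J f = Abs_mfps (\<lambda>I. (\<Prod>k\<in>UNIV. fact (I $ k + J $ k) / fact (I $ k)) * mfps_nth f (I + J))"

lemma mfps_nth_pd: "mfps_nth (mfps_pd k f) J = of_nat (J $ k + 1) * mfps_nth f (J + axis k 1)"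
  by (simp add: mfps_pd_def Abs_mfps_inverse)

lemma mfps_nth_Theta: "mfps_nth (Theta J f) I =
    (\<Prod>k\<in>UNIV. fact (I $ k + J $ k) / fact (I $ k)) * mfps_nth f (I + J)"
  by (simp add: Theta_def Abs_mfps_inverse)

lemma Theta_0: "Theta 0 f = f"
  by (rule mfps_eqI) (simp add: mfps_nth_Theta)

lemma Theta_add_axis:
  fixes f :: "('k::field_char_0, 'm::finite) mfps"
  shows "Theta (J + axis k 1) f = mfps_pd k (Theta J f)"
proof (rule mfps_eqI)
  fix I :: "nat ^ 'm"
  define F :: "nat \<Rightarrow> 'k" where "F = fact"
  have "(\<Prod>l\<in>UNIV. F (I $ l + (J + axis k 1) $ l) / F (I $ l))
      = (\<Prod>l\<in>UNIV. (if l = k then of_nat (I $ k + 1) else 1) *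
           (F ((I + axis k 1) $ l + J $ l) / F ((I + axis k 1) $ l)))"
  proof (rule prod.cong[OF refl])
    fix l :: 'm
    show "F (I $ l + (J + axis k 1) $ l) / F (I $ l) =
        (if l = k then of_nat (I $ k + 1) else 1) *
           (F ((I + axis k 1) $ l + J $ l) / F ((I + axis k 1) $ l))"
    proof (cases "l = k")
      case True
      have "(of_nat (I $ k + 1) :: 'k) \<noteq> 0" by (metis of_nat_neq_0 Suc_eq_plus1)
      with True show ?thesis by (simp add: F_def divide_simps)
    next
      case False
      then show ?thesis by (simp add: axis_def)
    qed
  qed
  also have "\<dots> = of_nat (I $ k + 1) *
      (\<Prod>l\<in>UNIV. F ((I + axis k 1) $ l + J $ l) / F ((I + axis k 1) $ l))"
    unfolding prod.distrib by (subst prod.delta) auto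
  finally show "mfps_nth (Theta (J + axis k 1) f) I = mfps_nth (mfps_pd k (Theta J f)) I"
    by (simp only: mfps_nth_Theta mfps_nth_pd F_def ac_simps)
qed


section \<open>Systems of homogeneous linear differential equations\<close>

text \<open>
  \<open>(i, J)\<close> stands for the derivative \<open>x\<^sub>i\<^sub>,\<^sub>J\<close>.  A homogeneous linear differential equation
  \<open>\<Sum> \<alpha>\<^sub>i\<^sub>,\<^sub>J x\<^sub>i\<^sub>,\<^sub>J\<close> is given by its finitely supported family of coefficients \<open>\<alpha>\<^sub>i\<^sub>,\<^sub>J \<in> K[[T]]\<close>.
\<close>

type_synonym ('n, 'm) dvar = "'n \<times> (nat ^ 'm)"

type_synonym ('k, 'n, 'm) lde = "('n, 'm) dvar \<Rightarrow>\<^sub>0 ('k, 'm) mfps"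

definition lde_subst ::
  "('k::field_char_0, 'n, 'm) lde \<Rightarrow> ('k, 'm::finite) mfps ^ 'n \<Rightarrow> ('k, 'm) mfps" where
  "lde_subst P \<phi> = (\<Sum>(i, J)\<in>Poly_Mapping.keys P. Poly_Mapping.lookup P (i, J) * Theta J (\<phi> $ i))"

definition Sol ::
  "('k::field_char_0, 'n::finite, 'm::finite) lde set \<Rightarrow> (('k, 'm) mfps ^ 'n) set" where
  "Sol \<Sigma> = {\<phi>. \<forall>P\<in>\<Sigma>. lde_subst P \<phi> = 0}"


section \<open>Differential type zero\<close>

definition dvar_deriv :: "nat ^ 'm \<Rightarrow> ('n, 'm::finite) dvar \<Rightarrow> ('n, 'm) dvar" where
  "dvar_deriv J v = (fst v, snd v + J)"

definition lde_pd :: "'m \<Rightarrow> ('k::field_char_0, 'n, 'm::finite) lde \<Rightarrow> ('k, 'n, 'm) lde" where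
  "lde_pd k P = (\<Sum>v\<in>Poly_Mapping.keys P.
      Poly_Mapping.single v (mfps_pd k (Poly_Mapping.lookup P v)) +
      Poly_Mapping.single (dvar_deriv (axis k 1) v) (Poly_Mapping.lookup P v))"

inductive_set lde_derivs :: "('k::field_char_0, 'n, 'm::finite) lde set \<Rightarrow> ('k, 'n, 'm) lde set"
  for \<Sigma> where
  base: "P \<in> \<Sigma> \<Longrightarrow> P \<in> lde_derivs \<Sigma>"
| pd: "P \<in> lde_derivs \<Sigma> \<Longrightarrow> lde_pd k P \<in> lde_derivs \<Sigma>"

text \<open>
  The differential polynomial ring \<open>F{x\<^sub>1, \<dots>, x\<^sub>n} = F[x\<^sub>i\<^sub>,\<^sub>J]\<close> over \<open>F = Frac(K[[T]])\<close>:
  finitely supported families of coefficients indexed by the monomials in the \<open>x\<^sub>i\<^sub>,\<^sub>J\<close>.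
\<close>

type_synonym ('k, 'n, 'm) dpoly = "(('n, 'm) dvar \<Rightarrow>\<^sub>0 nat) \<Rightarrow>\<^sub>0 ('k, 'm) mfps fract"

definition dpoly_of_lde :: "('k::field_char_0, 'n, 'm::finite) lde \<Rightarrow> ('k, 'n, 'm) dpoly" where
  "dpoly_of_lde P = (\<Sum>v\<in>Poly_Mapping.keys P.
      Poly_Mapping.single (Poly_Mapping.single v 1) (Fract (Poly_Mapping.lookup P v) 1))"

text \<open>
  The differential ideal generated by \<open>\<Sigma>\<close> in \<open>F{x\<^sub>1, \<dots>, x\<^sub>n}\<close> is the ideal generated by all
  derivatives \<open>\<Theta>(J)P\<close>, \<open>P \<in> \<Sigma>\<close>. Ideals are spans in the ring viewed as a module over itself.
\<close>

definition diff_ideal :: "('k::field_char_0, 'n, 'm::finite) lde set \<Rightarrow> ('k, 'n, 'm) dpoly set" where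
  "diff_ideal \<Sigma> = module.span (*) (dpoly_of_lde ` lde_derivs \<Sigma>)"

text \<open>The pair \<open>(u, v) \<in> r\<close> means that \<open>u\<close> is ranked at most as high as \<open>v\<close>.\<close>

definition ranking :: "('n, 'm::finite) dvar rel \<Rightarrow> bool" where
  "ranking r \<longleftrightarrow> well_order_on UNIV r \<and>
     (\<forall>u J. (u, dvar_deriv J u) \<in> r) \<and>
     (\<forall>u v J. (u, v) \<in> r \<longrightarrow> (dvar_deriv J u, dvar_deriv J v) \<in> r)"

definition dpoly_vars :: "('k::field_char_0, 'n, 'm::finite) dpoly \<Rightarrow> ('n, 'm) dvar set" where
  "dpoly_vars P = (\<Union>\<mu>\<in>Poly_Mapping.keys P. Poly_Mapping.keys \<mu>)"

definition dpoly_degree_in :: "('n, 'm) dvar \<Rightarrow> ('k::field_char_0, 'n, 'm::finite) dpoly \<Rightarrow> nat" where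
  "dpoly_degree_in v P = Max (insert 0 ((\<lambda>\<mu>. Poly_Mapping.lookup \<mu> v) ` Poly_Mapping.keys P))"

definition leader ::
  "('n, 'm) dvar rel \<Rightarrow> ('k::field_char_0, 'n, 'm::finite) dpoly \<Rightarrow> ('n, 'm) dvar" where
  "leader r P = (THE u. u \<in> dpoly_vars P \<and> (\<forall>v\<in>dpoly_vars P. (v, u) \<in> r))"

definition reduced_wrt ::
  "('n, 'm) dvar rel \<Rightarrow> ('k::field_char_0, 'n, 'm::finite) dpoly \<Rightarrow> ('k, 'n, 'm) dpoly \<Rightarrow> bool" where
  "reduced_wrt r P Q \<longleftrightarrow>
     (\<forall>J. J \<noteq> 0 \<longrightarrow> dvar_deriv J (leader r Q) \<notin> dpoly_vars P) \<and>
     dpoly_degree_in (leader r Q) P < dpoly_degree_in (leader r Q) Q"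

definition autoreduced ::
  "('n, 'm) dvar rel \<Rightarrow> ('k::field_char_0, 'n, 'm::finite) dpoly set \<Rightarrow> bool" where
  "autoreduced r \<Omega> \<longleftrightarrow>
     (\<forall>P\<in>\<Omega>. dpoly_vars P \<noteq> {}) \<and> (\<forall>P\<in>\<Omega>. \<forall>Q\<in>\<Omega>. P \<noteq> Q \<longrightarrow> reduced_wrt r P Q)"

text \<open>
  As usual, an autoreduced subset of a proper differential ideal is characteristic (that is, of
  lowest rank) iff the ideal contains no nonzero element that is reduced with respect to it.
\<close>

definition characteristic_set ::
  "('n, 'm) dvar rel \<Rightarrow> ('k::field_char_0, 'n, 'm::finite) dpoly set \<Rightarrow>
   ('k, 'n, 'm) dpoly set \<Rightarrow> bool" where
  "characteristic_set r I \<Omega> \<longleftrightarrow> \<Omega> \<subseteq> I \<and> autoreduced r \<Omega> \<and>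
     (\<forall>P\<in>I. P \<noteq> 0 \<longrightarrow> (\<exists>Q\<in>\<Omega>. \<not> reduced_wrt r P Q))"

definition leader_derivs ::
  "('n, 'm) dvar rel \<Rightarrow> ('k::field_char_0, 'n, 'm::finite) dpoly set \<Rightarrow> ('n, 'm) dvar set" where
  "leader_derivs r \<Omega> = {dvar_deriv J (leader r Q) | J Q. Q \<in> \<Omega>}"

text \<open>
  The number \<open>d\<close> of derivatives \<open>x\<^sub>i\<^sub>,\<^sub>J\<close> that are not derivatives of leaders depends neither on
  the ranking nor on the characteristic set, so the existential quantifier fixes some choice.
\<close>

definition differential_type_zero ::
  "('k::field_char_0, 'n::finite, 'm::finite) lde set \<Rightarrow> bool" where
  "differential_type_zero \<Sigma> \<longleftrightarrow>
     (\<exists>r \<Omega>. ranking r \<and> characteristic_set r (diff_ideal \<Sigma>) \<Omega> \<and>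
            finite (UNIV - leader_derivs r \<Omega>))"


section \<open>Supports\<close>

definition supp :: "('k::field_char_0, 'm::finite) mfps \<Rightarrow> (nat ^ 'm) set" where
  "supp w = {J. mfps_nth w J \<noteq> 0}"

definition supports ::
  "(('k::field_char_0, 'm::finite) mfps ^ 'n::finite) set \<Rightarrow> ((nat ^ 'm) set ^ 'n) set" where
  "supports X = (\<lambda>w. \<chi> i. supp (w $ i)) ` X"

text \<open>The order \<open>\<le>\<close> on vectors is the componentwise one, here the product of the inclusions.\<close>

definition min_supports ::
  "(('k::field_char_0, 'm::finite) mfps ^ 'n::finite) set \<Rightarrow> ((nat ^ 'm) set ^ 'n) set" where
  "min_supports X = {S \<in> supports X. S \<noteq> (\<chi> i. {}) \<and>
     (\<forall>S'\<in>supports X. S' \<noteq> (\<chi> i. {}) \<longrightarrow> S' \<le> S \<longrightarrow> S' = S)}"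

definition phi :: "(nat ^ 'm) set ^ 'n::finite \<Rightarrow> ('n \<times> (nat ^ 'm::finite)) set" where
  "phi S = (\<Union>i. {i} \<times> S $ i)"


section \<open>Infinite matroids\<close>

definition indep_of_circuits :: "'e set \<Rightarrow> 'e set set \<Rightarrow> 'e set set" where
  "indep_of_circuits E \<C> = {I. I \<subseteq> E \<and> (\<forall>C\<in>\<C>. \<not> C \<subseteq> I)}"

definition matroid_circuits :: "'e set \<Rightarrow> 'e set set \<Rightarrow> bool" where
  "matroid_circuits E \<C> \<longleftrightarrow> \<C> \<subseteq> Pow E \<and>
     {} \<notin> \<C> \<and>
     (\<forall>C\<in>\<C>. \<forall>C'\<in>\<C>. \<not> C \<subset> C') \<and>
     (\<forall>C\<in>\<C>. \<forall>X\<subseteq>C. \<forall>D. (\<forall>x\<in>X. D x \<in> \<C>) \<and> (\<forall>x\<in>X. \<forall>y\<in>X. x \<in> D y \<longleftrightarrow> x = y) \<longrightarrow>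
        (\<forall>z \<in> C - (\<Union>x\<in>X. D x). \<exists>C'\<in>\<C>. z \<in> C' \<and> C' \<subseteq> (C \<union> (\<Union>x\<in>X. D x)) - X)) \<and>
     (\<forall>I X. I \<subseteq> X \<and> X \<subseteq> E \<and> I \<in> indep_of_circuits E \<C> \<longrightarrow>
        (\<exists>M \<in> {I' \<in> indep_of_circuits E \<C>. I \<subseteq> I' \<and> I' \<subseteq> X}.
           \<forall>I' \<in> {I' \<in> indep_of_circuits E \<C>. I \<subseteq> I' \<and> I' \<subseteq> X}. M \<subseteq> I' \<longrightarrow> I' = M))"

definition scrawls :: "'e set set \<Rightarrow> 'e set set" where
  "scrawls \<C> = {\<Union>\<D> | \<D>. \<D> \<subseteq> \<C>}"

end

theory Submission
  imports Defs "HOL-Library.Function_Algebras"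
begin

text \<open>
  The theorem rests on one fact: the solution space of a system of differential type zero is a
  finite-dimensional \<open>K\<close>-vector space. Its dimension is at most the number \<open>d\<close> of derivatives
  \<open>x\<^sub>i\<^sub>,\<^sub>J\<close> that are not derivatives of leaders (\<open>Sol_dependent\<close>).

  To see this, take more than \<open>d\<close> solutions \<open>\<phi>\<^sub>a\<close>. Linear algebra over the domain \<open>K[[T]]\<close> gives
  power series \<open>c\<^sub>a\<close>, not all zero, such that \<open>\<Sum> c\<^sub>a \<Theta>(J) \<phi>\<^sub>a\<^sub>,\<^sub>i\<close> vanishes at the \<open>d\<close> pairs
  \<open>(i, J)\<close> that are not derivatives of leaders. By induction along the ranking it then vanishes at
  all pairs: every derivative of a leader is itself the leader of a linear equation satisfied by all
  solutions. Finally the coefficients of a monomial of least degree in the \<open>c\<^sub>a\<close> form a linear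
  relation over \<open>K\<close> between the \<open>\<phi>\<^sub>a\<close> (\<open>jets_dependent\<close>): evaluated at \<open>T = 0\<close>, the derivatives
  of \<open>\<phi>\<^sub>a\<close> are its Taylor coefficients up to factorials.

  A characteristic set consists of polynomials \<open>Q\<close> that need not be linear, so it has to be shown
  that the leader \<open>u\<close> of \<open>Q\<close> is the leader of a linear equation (\<open>characteristic_set_leader\<close>).
  Otherwise some linear functional \<open>\<Phi>\<close> on the linear forms over \<open>Frac(K[[T]])\<close> kills all equations
  satisfied by the solutions and all variables below \<open>u\<close>, but has \<open>\<Phi>(u) = 1\<close>. The derivation
  \<open>\<Sum> \<Phi>(v) \<partial>/\<partial>v\<close> maps the differential ideal into itself, and it maps \<open>Q\<close> to its separant
  \<open>\<partial>Q/\<partial>u\<close>. The separant is nonzero and reduced with respect to the characteristic set, which is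
  impossible for an element of the ideal.

  The minimal supports of any finite-dimensional space of functions are the circuits of a matroid.
  Everything needed about dimension is that there are no arbitrarily long triangular systems of
  functions (\<open>no_triangle\<close>). It bounds chains of supports, the sets along which circuits are
  eliminated, and the number of points needed to determine a function. If the ground set has fewer
  elements than the field, some \<open>f + c g\<close> has the union of the supports of \<open>f\<close> and \<open>g\<close> as its
  support, and since every scrawl is a finite union of circuits, every scrawl is a support.
\<close>

section \<open>Supports in a finite-dimensional space of functions\<close>

text \<open>The support of a function.\<close>

definition fsupp :: "('e \<Rightarrow> 'a::zero) \<Rightarrow> 'e set" where
  "fsupp f = {e. f e \<noteq> 0}"

lemma in_fsupp: "e \<in> fsupp f \<longleftrightarrow> f e \<noteq> 0"
  by (simp add: fsupp_def)

text \<open>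
  A vector space \<open>U\<close> of functions on \<open>'e\<close> of dimension at most \<open>d\<close>: any family of \<open>d + 1\<close>
  members is linearly dependent.
\<close>

locale findim_function_space =
  fixes U :: "('e \<Rightarrow> 'k::field) set" and d :: nat
  assumes zero_mem: "(\<lambda>_. 0) \<in> U"
    and comb_mem: "f \<in> U \<Longrightarrow> g \<in> U \<Longrightarrow> (\<lambda>e. f e + c * g e) \<in> U"
    and dependent: "(\<And>i. i \<le> d \<Longrightarrow> F i \<in> U) \<Longrightarrow>
      \<exists>c. (\<exists>i\<le>d. c i \<noteq> 0) \<and> (\<forall>e. (\<Sum>i\<le>d. c i * F i e) = 0)"
begin

lemma sum_mem:
  assumes "finite X" "\<And>x. x \<in> X \<Longrightarrow> F x \<in> U" "f \<in> U"
  shows "(\<lambda>e. f e + (\<Sum>x\<in>X. c x * F x e)) \<in> U"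
  using assms(1,2)
proof (induction X)
  case empty
  then show ?case using assms(3) by simp
next
  case (insert x X)
  have "(\<lambda>e. (f e + (\<Sum>x\<in>X. c x * F x e)) + c x * F x e) \<in> U"
    using insert by (intro comb_mem) auto
  then show ?case using insert by (simp add: algebra_simps)
qed

text \<open>
  A triangular family \<open>F 0, \<dots>, F d\<close> is linearly independent: evaluate a relation at the point
  \<open>e l\<close> for the first index \<open>l\<close> with a nonzero coefficient.
\<close>

lemma no_triangle:
  assumes mem: "\<And>i. i \<le> d \<Longrightarrow> F i \<in> U"
    and diag: "\<And>i. i \<le> d \<Longrightarrow> F i (e i) \<noteq> 0"
    and tri: "\<And>i j. i < j \<Longrightarrow> j \<le> d \<Longrightarrow> F j (e i) = 0"
  shows False
proof -
  obtain c k where c: "k \<le> d" "c k \<noteq> 0" "\<And>e. (\<Sum>i\<le>d. c i * F i e) = 0"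
    using dependent[of F] mem by blast
  define l where "l = (LEAST i. i \<le> d \<and> c i \<noteq> 0)"
  have l: "l \<le> d" "c l \<noteq> 0" "\<And>i. i < l \<Longrightarrow> c i = 0"
    using LeastI[of "\<lambda>i. i \<le> d \<and> c i \<noteq> 0" k] not_less_Least[of _ "\<lambda>i. i \<le> d \<and> c i \<noteq> 0"] c(1,2)
    unfolding l_def[symmetric] by (auto dest: less_imp_le)
  have "(\<Sum>i\<le>d. c i * F i (e l)) = (\<Sum>i\<in>{l}. c i * F i (e l))"
  proof (rule sum.mono_neutral_right)
    show "\<forall>i\<in>{..d} - {l}. c i * F i (e l) = 0"
    proof
      fix i assume "i \<in> {..d} - {l}"
      then consider "i < l" | "l < i" "i \<le> d" by fastforce
      then show "c i * F i (e l) = 0" using l(3) tri by cases auto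
    qed
  qed (use l in auto)
  with c(3)[of "e l"] l(1,2) diag[of l] show False by simp
qed

text \<open>
  If finitely many choices can always be followed by another one, there is an infinite sequence
  of choices. Combined with \<open>no_triangle\<close> this yields the finiteness statements below.
\<close>

lemma infinite_choice:
  assumes "\<And>Y. finite Y \<Longrightarrow> Y \<subseteq> A \<Longrightarrow> \<exists>p\<in>A. R Y p"
  shows "\<exists>s::nat \<Rightarrow> 'z. \<forall>n. s n \<in> A \<and> R (s ` {..<n}) (s n)"
proof (rule dependent_wellorder_choice)
  fix r and f g :: "nat \<Rightarrow> 'z" and x :: nat
  assume "\<And>y. y < x \<Longrightarrow> f y = g y"
  then have "f ` {..<x} = g ` {..<x}" by auto
  then show "(r \<in> A \<and> R (f ` {..<x}) r) = (r \<in> A \<and> R (g ` {..<x}) r)" by simp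
next
  fix x and f :: "nat \<Rightarrow> 'z"
  assume "\<And>y. y < x \<Longrightarrow> f y \<in> A \<and> R (f ` {..<y}) (f y)"
  then show "\<exists>r. r \<in> A \<and> R (f ` {..<x}) r"
    using assms[of "f ` {..<x}"] by blast
qed

text \<open>The minimal nonempty supports of members of \<open>U\<close>.\<close>

definition circuits :: "'e set set" where
  "circuits = {C \<in> fsupp ` U. C \<noteq> {} \<and> (\<forall>C'\<in>fsupp ` U. C' \<noteq> {} \<longrightarrow> C' \<subseteq> C \<longrightarrow> C' = C)}"

lemma wf_supports: "wf {(S, T). S \<in> fsupp ` U \<and> T \<in> fsupp ` U \<and> S \<subset> T}"
  unfolding wf_iff_no_infinite_down_chain
proof
  assume "\<exists>S. \<forall>i. (S (Suc i), S i) \<in> {(S, T). S \<in> fsupp ` U \<and> T \<in> fsupp ` U \<and> S \<subset> T}"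
  then obtain S where "\<forall>i. (S (Suc i), S i) \<in> {(S, T). S \<in> fsupp ` U \<and> T \<in> fsupp ` U \<and> S \<subset> T}"
    by blast
  then have S: "\<And>i. S i \<in> fsupp ` U" "\<And>i. S (Suc i) \<subset> S i" by simp_all
  have anti: "S j \<subseteq> S i" if "i \<le> j" for i j
    using that S(2) by (induction rule: dec_induct) blast+
  have "\<forall>i. \<exists>f. f \<in> U \<and> S i = fsupp f" using S(1) by auto
  then obtain f where f: "\<And>i. f i \<in> U" "\<And>i. S i = fsupp (f i)" by metis
  have "\<forall>i. \<exists>e. e \<in> S i - S (Suc i)" using S(2) by blast
  then obtain e where e: "\<And>i. e i \<in> S i" "\<And>i. e i \<notin> S (Suc i)" by (metis DiffE)
  show False
  proof (rule no_triangle[of f e])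
    fix i j :: nat assume "i < j"
    then have "S j \<subseteq> S (Suc i)" by (intro anti) simp
    with e(2)[of i] have "e i \<notin> S j" by blast
    then show "f j (e i) = 0" by (simp add: f in_fsupp)
  next
    fix i show "f i (e i) \<noteq> 0" using e(1)[of i] by (simp add: f in_fsupp)
  qed (rule f)
qed

lemma circuit_through:
  assumes "g \<in> U" "z \<in> fsupp g"
  shows "\<exists>C\<in>circuits. z \<in> C \<and> C \<subseteq> fsupp g"
proof -
  let ?Q = "{S \<in> fsupp ` U. z \<in> S \<and> S \<subseteq> fsupp g}"
  obtain S where S: "S \<in> ?Q"
    and min: "\<And>T. (T, S) \<in> {(S, T). S \<in> fsupp ` U \<and> T \<in> fsupp ` U \<and> S \<subset> T} \<Longrightarrow> T \<notin> ?Q"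
    using wfE_min[OF wf_supports, of "fsupp g" ?Q] assms by blast
  from S obtain h where h: "h \<in> U" "S = fsupp h" by blast
  have "S' = S" if S': "S' \<in> fsupp ` U" "S' \<noteq> {}" "S' \<subseteq> S" for S'
  proof (rule ccontr)
    assume ne: "S' \<noteq> S"
    from S' obtain h' y where h': "h' \<in> U" "S' = fsupp h'" "y \<in> S'" by blast
    have "z \<notin> S'" using min[of S'] S S' ne by auto
    \<comment> \<open>Subtracting a multiple of \<open>h'\<close> removes \<open>y\<close> from the support of \<open>h\<close>, but keeps \<open>z\<close>.\<close>
    define k where "k = (\<lambda>e. h e + (- h y / h' y) * h' e)"
    have k: "k \<in> U" unfolding k_def using h h' by (intro comb_mem)
    have "z \<in> fsupp k"
      using S h(2) h'(2) \<open>z \<notin> S'\<close> by (auto simp: in_fsupp k_def)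
    moreover have "fsupp k \<subseteq> S"
    proof
      fix e assume "e \<in> fsupp k"
      then have "e \<in> fsupp h \<or> e \<in> fsupp h'" by (auto simp: in_fsupp k_def)
      then show "e \<in> S" using h h' S' by auto
    qed
    moreover have "y \<notin> fsupp k" "y \<in> S"
      using h' S' by (auto simp: in_fsupp k_def)
    ultimately have "fsupp k \<in> ?Q" "(fsupp k, S) \<in> {(S, T). S \<in> fsupp ` U \<and> T \<in> fsupp ` U \<and> S \<subset> T}"
      using S k by auto
    with min show False by blast
  qed
  with S have "S \<in> circuits" unfolding circuits_def by blast
  with S show ?thesis by blast
qed

text \<open>
  The strong elimination axiom. Subtracting multiples of functions with supports \<open>D x\<close> clears the
  values on \<open>X\<close>; the sum is finite because these functions form a triangle.
\<close>

lemma circuits_elim: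
  assumes C: "C \<in> circuits" and X: "X \<subseteq> C" and D: "\<And>x. x \<in> X \<Longrightarrow> D x \<in> circuits"
    and XD: "\<And>x y. x \<in> X \<Longrightarrow> y \<in> X \<Longrightarrow> x \<in> D y \<longleftrightarrow> x = y"
    and z: "z \<in> C - (\<Union>x\<in>X. D x)"
  shows "\<exists>C'\<in>circuits. z \<in> C' \<and> C' \<subseteq> (C \<union> (\<Union>x\<in>X. D x)) - X"
proof -
  obtain f where f: "f \<in> U" "C = fsupp f" using C by (auto simp: circuits_def)
  have "\<exists>g. g \<in> U \<and> D x = fsupp g" if "x \<in> X" for x
    using D[OF that] by (auto simp: circuits_def)
  then obtain F where F: "\<And>x. x \<in> X \<Longrightarrow> F x \<in> U" "\<And>x. x \<in> X \<Longrightarrow> D x = fsupp (F x)" by metis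
  have F0: "F y x = 0 \<longleftrightarrow> x \<noteq> y" if "x \<in> X" "y \<in> X" for x y
    using XD[OF that] F(2)[OF that(2)] by (auto simp: in_fsupp)
  have fin: "finite X"
  proof (rule ccontr)
    assume "infinite X"
    then obtain s :: "nat \<Rightarrow> 'e" where s: "inj s" "range s \<subseteq> X"
      using infinite_countable_subset by blast
    then have sX: "s i \<in> X" for i by blast
    show False
    proof (rule no_triangle[of "\<lambda>i. F (s i)" s])
      fix i j :: nat assume "i < j"
      with s(1) have "s i \<noteq> s j" by (metis injD nat_neq_iff)
      with F0 sX show "F (s j) (s i) = 0" by blast
    qed (use F F0 sX in blast)+
  qed
  define g where "g = (\<lambda>e. f e + (\<Sum>x\<in>X. (- f x / F x x) * F x e))"
  have g: "g \<in> U" unfolding g_def using fin F(1) f(1) by (rule sum_mem)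
  have out: "g e = f e" if "e \<notin> (\<Union>x\<in>X. D x)" for e
  proof -
    have "F x e = 0" if "x \<in> X" for x
      using that \<open>e \<notin> _\<close> F(2) by (auto simp: in_fsupp)
    then show ?thesis by (simp add: g_def)
  qed
  have "g y = 0" if "y \<in> X" for y
  proof -
    have "(\<Sum>x\<in>X. (- f x / F x x) * F x y) = (\<Sum>x\<in>{y}. (- f x / F x x) * F x y)"
      using fin that F0 by (intro sum.mono_neutral_right) auto
    then show ?thesis using F0[OF that that] by (simp add: g_def)
  qed
  then have sub: "fsupp g \<subseteq> (C \<union> (\<Union>x\<in>X. D x)) - X"
    using out by (auto simp: in_fsupp f(2))
  have "z \<in> fsupp g" using out[of z] z f(2) by (auto simp: in_fsupp)
  from circuit_through[OF g this] sub show ?thesis by blast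
qed

lemma indep_iff:
  "I \<in> indep_of_circuits UNIV circuits \<longleftrightarrow> (\<forall>g\<in>U. fsupp g \<subseteq> I \<longrightarrow> fsupp g = {})"
proof -
  have "(\<forall>C\<in>circuits. \<not> C \<subseteq> I) \<longleftrightarrow> (\<forall>g\<in>U. fsupp g \<subseteq> I \<longrightarrow> fsupp g = {})"
  proof (intro iffI ballI impI notI)
    fix g assume *: "\<forall>C\<in>circuits. \<not> C \<subseteq> I" "g \<in> U" "fsupp g \<subseteq> I"
    show "fsupp g = {}"
    proof (rule ccontr)
      assume "fsupp g \<noteq> {}"
      then obtain z where "z \<in> fsupp g" by blast
      with * circuit_through[of g z] show False by blast
    qed
  next
    fix C assume "\<forall>g\<in>U. fsupp g \<subseteq> I \<longrightarrow> fsupp g = {}" "C \<in> circuits" "C \<subseteq> I"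
    then show False by (auto simp: circuits_def)
  qed
  then show ?thesis by (simp add: indep_of_circuits_def)
qed

text \<open>
  For an independent set \<open>I \<subseteq> X\<close>, the members of \<open>U\<close> supported in \<open>X\<close> are determined by their
  values on \<open>X - I\<close>, hence on a finite part of it; removing from \<open>X\<close> such a part of least
  cardinality leaves a maximal independent set.
\<close>

lemma circuits_maximal:
  assumes IX: "I \<subseteq> X" and I: "I \<in> indep_of_circuits UNIV circuits"
  shows "\<exists>M \<in> {I' \<in> indep_of_circuits UNIV circuits. I \<subseteq> I' \<and> I' \<subseteq> X}.
    \<forall>I' \<in> {I' \<in> indep_of_circuits UNIV circuits. I \<subseteq> I' \<and> I' \<subseteq> X}. M \<subseteq> I' \<longrightarrow> I' = M"
proof -
  define det where "det Y \<longleftrightarrow> (\<forall>g\<in>U. fsupp g \<subseteq> X \<longrightarrow> fsupp g \<inter> Y = {} \<longrightarrow> fsupp g = {})" for Y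
  have ind: "X - Y \<in> indep_of_circuits UNIV circuits \<longleftrightarrow> det Y" for Y
  proof -
    have "fsupp g \<subseteq> X - Y \<longleftrightarrow> fsupp g \<subseteq> X \<and> fsupp g \<inter> Y = {}" for g :: "'e \<Rightarrow> 'k"
      by blast
    then show ?thesis unfolding indep_iff det_def by (simp only: imp_conjL)
  qed
  have "\<exists>Y. finite Y \<and> Y \<subseteq> X - I \<and> det Y"
  proof (rule ccontr)
    assume no: "\<not> ?thesis"
    define R where "R Y y \<longleftrightarrow> (\<exists>g\<in>U. fsupp g \<inter> Y = {} \<and> g y \<noteq> 0)" for Y y
    have step: "\<exists>y\<in>X - I. R Y y" if Y: "finite Y" "Y \<subseteq> X - I" for Y
    proof -
      from no Y have "\<not> det Y" by blast
      then obtain g where g: "g \<in> U" "fsupp g \<subseteq> X" "fsupp g \<inter> Y = {}" "fsupp g \<noteq> {}"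
        unfolding det_def by (simp only: Ball_def not_all not_imp) (elim exE conjE, rule that)
      with I obtain y where "y \<in> fsupp g" "y \<notin> I" unfolding indep_iff by blast
      with g show ?thesis unfolding R_def by (auto simp: in_fsupp)
    qed
    have "\<exists>s :: nat \<Rightarrow> _. \<forall>n. s n \<in> X - I \<and> R (s ` {..<n}) (s n)"
      by (rule infinite_choice) (rule step)
    then obtain s :: "nat \<Rightarrow> _" where "\<forall>n. s n \<in> X - I \<and> R (s ` {..<n}) (s n)" ..
    then have s: "R (s ` {..<n}) (s n)" for n by simp
    have "\<forall>n. \<exists>g. g \<in> U \<and> fsupp g \<inter> s ` {..<n} = {} \<and> g (s n) \<noteq> 0"
      using s unfolding R_def by (simp add: Bex_def)
    then obtain F where F: "\<And>n. F n \<in> U" "\<And>n. fsupp (F n) \<inter> s ` {..<n} = {}"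
      "\<And>n. F n (s n) \<noteq> 0" by metis
    show False
    proof (rule no_triangle[of F s])
      fix i j :: nat assume "i < j"
      then have "s i \<in> s ` {..<j}" by blast
      with F(2)[of j] show "F j (s i) = 0" by (auto simp: fsupp_def)
    qed (rule F)+
  qed
  then obtain Y0 where "finite Y0 \<and> Y0 \<subseteq> X - I \<and> det Y0" ..
  from ex_has_least_nat[of "\<lambda>Y. finite Y \<and> Y \<subseteq> X - I \<and> det Y", OF this, of card]
  obtain Y where Y: "finite Y" "Y \<subseteq> X - I" "det Y"
    and min: "\<And>Y'. finite Y' \<Longrightarrow> Y' \<subseteq> X - I \<Longrightarrow> det Y' \<Longrightarrow> card Y \<le> card Y'"
    by (elim exE conjE) simp
  show ?thesis
  proof (intro bexI[of _ "X - Y"] ballI impI)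
    show "X - Y \<in> {I' \<in> indep_of_circuits UNIV circuits. I \<subseteq> I' \<and> I' \<subseteq> X}"
      using Y(2,3) ind[of Y] IX by auto
  next
    fix I' assume I': "I' \<in> {I' \<in> indep_of_circuits UNIV circuits. I \<subseteq> I' \<and> I' \<subseteq> X}" "X - Y \<subseteq> I'"
    then have "X - (X - I') = I'" by blast
    with I' ind[of "X - I'"] have "det (X - I')" by simp
    moreover have "X - I' \<subseteq> Y" "X - I' \<subseteq> X - I" using I' by blast+
    ultimately have "card Y \<le> card (X - I')" "X - I' \<subseteq> Y"
      using min[of "X - I'"] finite_subset[OF _ Y(1)] by simp_all
    then have "X - I' = Y" using Y(1) by (simp add: card_seteq)
    then show "I' = X - Y" using I' by blast
  qed
qed

theorem matroid_circuits_circuits: "matroid_circuits UNIV circuits"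
  unfolding matroid_circuits_def
proof (intro conjI)
  show "{} \<notin> circuits" by (simp add: circuits_def)
  show "\<forall>C\<in>circuits. \<forall>C'\<in>circuits. \<not> C \<subset> C'" unfolding circuits_def by blast
  show "\<forall>C\<in>circuits. \<forall>X\<subseteq>C. \<forall>D. (\<forall>x\<in>X. D x \<in> circuits) \<and> (\<forall>x\<in>X. \<forall>y\<in>X. (x \<in> D y) = (x = y)) \<longrightarrow>
      (\<forall>z\<in>C - \<Union> (D ` X). \<exists>C'\<in>circuits. z \<in> C' \<and> C' \<subseteq> C \<union> \<Union> (D ` X) - X)"
  proof (intro ballI allI impI)
    fix C X D z
    assume "C \<in> circuits" "X \<subseteq> C" "z \<in> C - \<Union> (D ` X)"
      "(\<forall>x\<in>X. D x \<in> circuits) \<and> (\<forall>x\<in>X. \<forall>y\<in>X. (x \<in> D y) = (x = y))"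
    then show "\<exists>C'\<in>circuits. z \<in> C' \<and> C' \<subseteq> C \<union> \<Union> (D ` X) - X"
      by (intro circuits_elim) simp_all
  qed
next
  show "\<forall>I X. I \<subseteq> X \<and> X \<subseteq> UNIV \<and> I \<in> indep_of_circuits UNIV circuits \<longrightarrow>
      (\<exists>M \<in> {I' \<in> indep_of_circuits UNIV circuits. I \<subseteq> I' \<and> I' \<subseteq> X}.
        \<forall>I' \<in> {I' \<in> indep_of_circuits UNIV circuits. I \<subseteq> I' \<and> I' \<subseteq> X}. M \<subseteq> I' \<longrightarrow> I' = M)"
    using circuits_maximal by (intro allI impI) (elim conjE)
qed simp

text \<open>
  In \<open>f + c g\<close> a cancellation at a point \<open>e\<close> forces \<open>c = - f(e)/g(e)\<close>, which excludes too few
  scalars to exhaust the field.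
\<close>

lemma supports_Un:
  assumes small: "(UNIV :: 'e set) \<prec> (UNIV :: 'k set)" and "f \<in> U" "g \<in> U"
  shows "fsupp f \<union> fsupp g \<in> fsupp ` U"
proof -
  have "range (\<lambda>e. - f e / g e) \<noteq> UNIV"
  proof
    assume "range (\<lambda>e. - f e / g e) = UNIV"
    then have "(UNIV :: 'k set) \<lesssim> (UNIV :: 'e set)" by (metis image_lepoll)
    with small show False 
      using lepoll_antisym[of "UNIV :: 'e set" "UNIV :: 'k set"] by (simp add: lesspoll_def)
  qed
  then obtain c where c: "\<And>e. c \<noteq> - f e / g e" by blast
  have "fsupp (\<lambda>e. f e + c * g e) = fsupp f \<union> fsupp g"
  proof (intro set_eqI)
    fix e
    have "f e + c * g e \<noteq> 0" if "g e \<noteq> 0"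
      using c[of e] that by (auto simp: field_simps add_eq_0_iff)
    then show "e \<in> fsupp (\<lambda>e. f e + c * g e) \<longleftrightarrow> e \<in> fsupp f \<union> fsupp g"
      by (cases "g e = 0") (auto simp: in_fsupp)
  qed
  then show ?thesis using comb_mem[OF assms(2,3)] by (metis image_eqI)
qed

lemma finite_subcover:
  assumes "\<D> \<subseteq> fsupp ` U"
  shows "\<exists>\<F>\<subseteq>\<D>. finite \<F> \<and> \<Union>\<F> = \<Union>\<D>"
proof (rule ccontr)
  assume no: "\<not> ?thesis"
  define R where "R \<F> D \<longleftrightarrow> \<not> D \<subseteq> \<Union>\<F>" for \<F> and D :: "'e set"
  have step: "\<exists>D\<in>\<D>. R \<F> D" if "finite \<F>" "\<F> \<subseteq> \<D>" for \<F>
  proof (rule ccontr)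
    assume "\<not> ?thesis"
    then have "\<Union>\<D> \<subseteq> \<Union>\<F>" unfolding R_def by (intro Union_least) simp
    moreover have "\<Union>\<F> \<subseteq> \<Union>\<D>" using that by (intro Union_mono)
    ultimately show False using no that by (meson subset_antisym)
  qed
  have "\<exists>D :: nat \<Rightarrow> _. \<forall>n. D n \<in> \<D> \<and> R (D ` {..<n}) (D n)"
    by (rule infinite_choice) (rule step)
  then obtain D :: "nat \<Rightarrow> _" where D: "\<forall>n. D n \<in> \<D> \<and> R (D ` {..<n}) (D n)" ..
  have "\<forall>n. \<exists>e. e \<in> D n \<and> (\<forall>i<n. e \<notin> D i)" 
    using D unfolding R_def by (meson UN_I lessThan_iff subsetI)
  then obtain e where e: "\<And>n. e n \<in> D n" "\<And>n i. i < n \<Longrightarrow> e n \<notin> D i" by metis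
  have "\<forall>n. \<exists>g. g \<in> U \<and> D n = fsupp g" using D assms by blast
  then obtain F where F: "\<And>n. F n \<in> U" "\<And>n. D n = fsupp (F n)" by metis
  \<comment> \<open>Here earlier functions vanish at later points, so the order has to be reversed.\<close>
  show False
  proof (rule no_triangle[of "\<lambda>i. F (d - i)" "\<lambda>i. e (d - i)"])
    fix i j :: nat assume "i < j" "j \<le> d"
    then have "e (d - i) \<notin> D (d - j)" by (intro e(2)) simp
    then show "F (d - j) (e (d - i)) = 0" by (simp add: F in_fsupp)
  next
    fix i show "F (d - i) (e (d - i)) \<noteq> 0" using e(1)[of "d - i"] by (simp add: F in_fsupp)
  qed (rule F)
qed

theorem supports_eq_scrawls:
  assumes small: "(UNIV :: 'e set) \<prec> (UNIV :: 'k set)"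
  shows "fsupp ` U = scrawls circuits"
proof (intro equalityI subsetI)
  fix S assume "S \<in> fsupp ` U"
  then obtain g where g: "g \<in> U" "S = fsupp g" by blast
  then have "S = \<Union>{C \<in> circuits. C \<subseteq> S}"
    using circuit_through[of g] by blast
  then show "S \<in> scrawls circuits" unfolding scrawls_def by blast
next
  fix S assume "S \<in> scrawls circuits"
  then obtain \<D> where D: "\<D> \<subseteq> circuits" "S = \<Union>\<D>" unfolding scrawls_def by blast
  then have DU: "\<D> \<subseteq> fsupp ` U" by (auto simp: circuits_def)
  then obtain \<F> where F: "\<F> \<subseteq> \<D>" "finite \<F>" "\<Union>\<F> = S" using finite_subcover D(2) by metis
  have "\<Union>\<F> \<in> fsupp ` U" if "\<F> \<subseteq> fsupp ` U" using F(2) that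
  proof (induction \<F>)
    case empty
    have "fsupp (\<lambda>_. 0) = {}" by (simp add: fsupp_def)
    then show ?case using zero_mem by (metis Union_empty image_eqI)
  next
    case (insert C \<F>)
    then obtain f g where fg: "f \<in> U" "g \<in> U" "C = fsupp f" "\<Union>\<F> = fsupp g" by auto
    with supports_Un[OF small fg(1,2)] show ?case by simp
  qed
  then show "S \<in> fsupp ` U" using F DU by blast
qed

end


section \<open>Differential operators on power series\<close>

lemma mfps_nth_0 [simp]: "mfps_nth 0 J = 0"
  by (simp add: zero_mfps.rep_eq)

lemma mfps_nth_add [simp]: "mfps_nth (f + g) J = mfps_nth f J + mfps_nth g J"
  by (simp add: plus_mfps.rep_eq)

lemma mfps_nth_times: "mfps_nth (f * g) J = (\<Sum>p\<in>splits J. mfps_nth f (fst p) * mfps_nth g (snd p))"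
  by (simp add: times_mfps.rep_eq case_prod_unfold)

lemma mfps_nth_sum: "mfps_nth (sum f A) J = (\<Sum>a\<in>A. mfps_nth (f a) J)"
  by (induction A rule: infinite_finite_induct) simp_all

lemma mfps_nth_of_nat: "mfps_nth (of_nat n) J = (if J = 0 then of_nat n else 0)"
  by (induction n) (simp_all add: one_mfps.rep_eq)

lemma of_nat_mfps_fract_neq_0:
  "of_nat (Suc n) \<noteq> (0 :: ('k::field_char_0, 'm::finite) mfps fract)"
proof
  assume "of_nat (Suc n) = (0 :: ('k, 'm) mfps fract)"
  then have "of_nat (Suc n) = (0 :: ('k, 'm) mfps)"
    by (metis of_nat_fract Zero_fract_def eq_fract(1) mult_1_right zero_neq_one)
  then have "mfps_nth (of_nat (Suc n) :: ('k, 'm) mfps) 0 = 0" by simp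
  then show False unfolding mfps_nth_of_nat by (simp del: of_nat_Suc)
qed

lemma mfps_pd_add: "mfps_pd k (f + g) = mfps_pd k f + mfps_pd k g"
  by (rule mfps_eqI) (simp add: mfps_nth_pd distrib_left)

lemma mfps_pd_0: "mfps_pd k 0 = 0"
  by (rule mfps_eqI) (simp add: mfps_nth_pd)

lemma mfps_pd_sum: "mfps_pd k (sum f A) = (\<Sum>a\<in>A. mfps_pd k (f a))"
  by (induction A rule: infinite_finite_induct) (simp_all add: mfps_pd_add mfps_pd_0)

text \<open>
  The reindexing behind the product rule: terms whose first exponent is \<open>0\<close> in the variable
  \<open>t\<^sub>k\<close> have weight \<open>0\<close>, all others arise from splittings of \<open>J\<close>.
\<close>

lemma sum_splits_weight:
  fixes k :: "'m::finite" and J :: "nat ^ 'm" and F :: "nat ^ 'm \<Rightarrow> nat ^ 'm \<Rightarrow> 'k::comm_ring_1"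
  shows "(\<Sum>p\<in>splits (J + axis k 1). of_nat (fst p $ k) * F (fst p) (snd p)) =
    (\<Sum>p\<in>splits J. of_nat (fst p $ k + 1) * F (fst p + axis k 1) (snd p))"
proof -
  define a :: "nat ^ 'm" where "a = axis k 1"
  let ?h = "\<lambda>p :: (nat ^ 'm) \<times> (nat ^ 'm). of_nat (fst p $ k) * F (fst p) (snd p)"
  have ak: "a $ l = (if l = k then 1 else 0)" for l by (simp add: a_def axis_def)
  have cancel: "A - a + a = A" if "A $ k \<noteq> 0" for A
    using that by (auto simp: vec_eq_iff ak)
  have "(\<Sum>p\<in>splits (J + a). ?h p) = (\<Sum>p\<in>{p \<in> splits (J + a). fst p $ k \<noteq> 0}. ?h p)"
    by (rule sum.mono_neutral_right) auto
  also have "\<dots> = (\<Sum>p\<in>splits J. of_nat (fst p $ k + 1) * F (fst p + a) (snd p))"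
  proof (rule sum.reindex_bij_witness
      [where j = "\<lambda>p. (fst p - a, snd p)" and i = "\<lambda>p. (fst p + a, snd p)"])
    fix p assume p: "p \<in> {p \<in> splits (J + a). fst p $ k \<noteq> 0}"
    then have c: "fst p - a + a = fst p" by (intro cancel) simp
    show "(fst (fst p - a, snd p) + a, snd (fst p - a, snd p)) = p" by (simp add: c)
    have "fst p - a + snd p + a = J + a"
      using p c by (auto simp: splits_def add.assoc add.commute[of "snd p"]) (simp flip: add.assoc)
    then show "(fst p - a, snd p) \<in> splits J" by (simp add: splits_def)
    have "(fst p - a) $ k + 1 = fst p $ k" using p by (simp add: ak)
    then show "of_nat (fst (fst p - a, snd p) $ k + 1) *
        F (fst (fst p - a, snd p) + a) (snd (fst p - a, snd p)) = ?h p"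
      by (simp only: fst_conv snd_conv c)
  next
    fix p assume p: "p \<in> splits J"
    show "(fst (fst p + a, snd p) - a, snd (fst p + a, snd p)) = p"
      by (simp add: vec_eq_iff prod_eq_iff)
    show "(fst p + a, snd p) \<in> {p \<in> splits (J + a). fst p $ k \<noteq> 0}"
      using p by (auto simp: splits_def ak algebra_simps)
  qed
  finally show ?thesis unfolding a_def .
qed

lemma splits_swap: "(\<Sum>p\<in>splits J. h (snd p) (fst p)) = (\<Sum>p\<in>splits J. h (fst p) (snd p))"
  by (rule sum.reindex_bij_witness[where i = prod.swap and j = prod.swap])
    (auto simp: splits_def add.commute)

lemma mfps_pd_mult: "mfps_pd k (f * g) = mfps_pd k f * g + f * mfps_pd k g"
proof (rule mfps_eqI)
  fix J :: "nat ^ 'b"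
  let ?f = "mfps_nth f" and ?g = "mfps_nth g" and ?J = "J + axis k 1"
  have "mfps_nth (mfps_pd k (f * g)) J = of_nat (J $ k + 1) * (\<Sum>p\<in>splits ?J. ?f (fst p) * ?g (snd p))"
    by (simp only: mfps_nth_pd mfps_nth_times)
  also have "\<dots> = (\<Sum>p\<in>splits ?J. of_nat (fst p $ k) * (?f (fst p) * ?g (snd p))
      + of_nat (snd p $ k) * (?f (fst p) * ?g (snd p)))"
    unfolding sum_distrib_left
  proof (rule sum.cong[OF refl])
    fix p assume "p \<in> splits ?J"
    then have "fst p + snd p = ?J" by (auto simp: splits_def)
    then have "fst p $ k + snd p $ k = ?J $ k" by (metis vector_add_component)
    then have *: "J $ k + 1 = fst p $ k + snd p $ k" by simp
    show "of_nat (J $ k + 1) * (?f (fst p) * ?g (snd p)) = of_nat (fst p $ k) * (?f (fst p) * ?g (snd p))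
      + of_nat (snd p $ k) * (?f (fst p) * ?g (snd p))"
      unfolding * by (simp only: of_nat_add distrib_right)
  qed
  also have "\<dots> = (\<Sum>p\<in>splits J. of_nat (fst p $ k + 1) * (?f (fst p + axis k 1) * ?g (snd p)))
      + (\<Sum>p\<in>splits J. of_nat (snd p $ k + 1) * (?f (fst p) * ?g (snd p + axis k 1)))"
    unfolding sum.distrib
    using sum_splits_weight[where J = J and k = k and F = "\<lambda>A B. ?f A * ?g B"]
      sum_splits_weight[where J = J and k = k and F = "\<lambda>A B. ?f B * ?g A"]
      splits_swap[where J = "J + axis k 1" and h = "\<lambda>A B. of_nat (B $ k) * (?f A * ?g B)"]
      splits_swap[where J = J and h = "\<lambda>A B. of_nat (B $ k + 1) * (?f A * ?g (B + axis k 1))"]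
    by simp
  also have "\<dots> = mfps_nth (mfps_pd k f * g + f * mfps_pd k g) J"
    unfolding mfps_nth_add mfps_nth_times mfps_nth_pd by (simp only: ac_simps)
  finally show "mfps_nth (mfps_pd k (f * g)) J = mfps_nth (mfps_pd k f * g + f * mfps_pd k g) J" .
qed

lemma Theta_add: "Theta J (f + g) = Theta J f + Theta J g"
  by (rule mfps_eqI) (simp add: mfps_nth_Theta distrib_left)

text \<open>The constant power series \<open>c\<close>.\<close>

definition mfps_const :: "'k::field_char_0 \<Rightarrow> ('k, 'm::finite) mfps" where
  "mfps_const c = Abs_mfps (\<lambda>J. if J = 0 then c else 0)"

lemma mfps_nth_const: "mfps_nth (mfps_const c) J = (if J = 0 then c else 0)"
  by (simp add: mfps_const_def Abs_mfps_inverse)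

lemma mfps_nth_const_mult:
  "mfps_nth (mfps_const c * (f :: ('a::field_char_0, 'b::finite) mfps)) J = c * mfps_nth f J"
proof -
  have "mfps_nth (mfps_const c * f) J
      = (\<Sum>p\<in>{(0, J)}. mfps_nth (mfps_const c :: ('a, 'b) mfps) (fst p) * mfps_nth f (snd p))"
    unfolding mfps_nth_times
    by (rule sum.mono_neutral_right[OF finite_splits]) (auto simp: splits_def mfps_nth_const)
  then show ?thesis by (simp add: mfps_nth_const)
qed

lemma Theta_const_mult: "Theta J (mfps_const c * f) = mfps_const c * Theta J f"
  by (rule mfps_eqI) (simp add: mfps_nth_Theta mfps_nth_const_mult)


section \<open>Equations satisfied by a solution\<close>

text \<open>The value \<open>\<Theta>(J) \<phi>\<^sub>i\<close> that is substituted for the variable \<open>v = (i, J)\<close>.\<close>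

definition jet :: "('k::field_char_0, 'm::finite) mfps ^ 'n \<Rightarrow> ('n, 'm) dvar \<Rightarrow> ('k, 'm) mfps" where
  "jet \<phi> v = Theta (snd v) (\<phi> $ fst v)"

lemma jet_dvar_deriv_axis: "jet \<phi> (dvar_deriv (axis k 1) v) = mfps_pd k (jet \<phi> v)"
  by (simp add: jet_def dvar_deriv_def Theta_add_axis del: One_nat_def)

lemma lde_subst_superset:
  assumes "finite V" "Poly_Mapping.keys P \<subseteq> V"
  shows "lde_subst P \<phi> = (\<Sum>v\<in>V. Poly_Mapping.lookup P v * jet \<phi> v)"
proof -
  have "lde_subst P \<phi> = (\<Sum>v\<in>Poly_Mapping.keys P. Poly_Mapping.lookup P v * jet \<phi> v)"
    by (simp add: lde_subst_def jet_def case_prod_unfold)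
  also have "\<dots> = (\<Sum>v\<in>V. Poly_Mapping.lookup P v * jet \<phi> v)"
    using assms by (intro sum.mono_neutral_left) (auto simp: in_keys_iff)
  finally show ?thesis .
qed

lemmas lde_subst_jet = lde_subst_superset[OF finite_keys order_refl]

lemma lde_subst_0: "lde_subst 0 \<phi> = 0"
  by (simp add: lde_subst_def)

lemma lde_subst_add: "lde_subst (P + Q) \<phi> = lde_subst P \<phi> + lde_subst Q \<phi>"
proof -
  let ?V = "Poly_Mapping.keys P \<union> Poly_Mapping.keys Q"
  have "Poly_Mapping.keys (P + Q) \<subseteq> ?V" by (rule keys_add)
  then show ?thesis
    by (simp add: lde_subst_superset[of ?V] lookup_add algebra_simps sum.distrib)
qed

lemma lde_subst_sum: "lde_subst (sum P A) \<phi> = (\<Sum>a\<in>A. lde_subst (P a) \<phi>)"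
  by (induction A rule: infinite_finite_induct) (simp_all add: lde_subst_add lde_subst_0)

lemma lde_subst_single: "lde_subst (Poly_Mapping.single v a) \<phi> = a * jet \<phi> v"
  by (simp add: lde_subst_superset[of "{v}"])

lemma lde_subst_pd: "lde_subst (lde_pd k P) \<phi> = mfps_pd k (lde_subst P \<phi>)"
  by (simp add: lde_pd_def lde_subst_jet[of P] lde_subst_sum lde_subst_add lde_subst_single
      jet_dvar_deriv_axis mfps_pd_sum mfps_pd_mult del: One_nat_def)

text \<open>
  All linear equations satisfied by every vector in \<open>X\<close>. For \<open>X = Sol \<Sigma>\<close> this contains the
  derivatives of \<open>\<Sigma>\<close>, and it is closed under derivations and \<open>K[[T]]\<close>-linear combinations.
\<close>

definition annihilating :: "(('k::field_char_0, 'm::finite) mfps ^ 'n) set \<Rightarrow> ('k, 'n, 'm) lde set" where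
  "annihilating X = {P. \<forall>\<phi>\<in>X. lde_subst P \<phi> = 0}"

lemma annihilating_pd: "P \<in> annihilating X \<Longrightarrow> lde_pd k P \<in> annihilating X"
  by (simp add: annihilating_def lde_subst_pd mfps_pd_0)

lemma lde_derivs_annihilating: "P \<in> lde_derivs \<Sigma> \<Longrightarrow> P \<in> annihilating (Sol \<Sigma>)"
  by (induction rule: lde_derivs.induct) (auto simp: annihilating_pd, auto simp: annihilating_def Sol_def)

lemma annihilating_0: "0 \<in> annihilating X"
  by (simp add: annihilating_def lde_subst_0)

lemma annihilating_add: "P \<in> annihilating X \<Longrightarrow> Q \<in> annihilating X \<Longrightarrow> P + Q \<in> annihilating X"
  by (simp add: annihilating_def lde_subst_add)

text \<open>The product of a linear form with a power series.\<close>

definition lde_scale :: "('k::field_char_0, 'm::finite) mfps \<Rightarrow> ('k, 'n, 'm) lde \<Rightarrow> ('k, 'n, 'm) lde" where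
  "lde_scale a P = Poly_Mapping.map ((*) a) P"

lemma lookup_lde_scale: "Poly_Mapping.lookup (lde_scale a P) v = a * Poly_Mapping.lookup P v"
  by (simp add: lde_scale_def map.rep_eq when_def)

lemma annihilating_scale: "P \<in> annihilating X \<Longrightarrow> lde_scale a P \<in> annihilating X"
proof -
  have "Poly_Mapping.keys (lde_scale a P) \<subseteq> Poly_Mapping.keys P"
    by (auto simp: in_keys_iff lookup_lde_scale)
  then have "lde_subst (lde_scale a P) \<phi> = a * lde_subst P \<phi>" for \<phi>
    by (simp add: lde_subst_superset[of "Poly_Mapping.keys P"] lookup_lde_scale
        sum_distrib_left mult.assoc)
  then show "P \<in> annihilating X \<Longrightarrow> lde_scale a P \<in> annihilating X"
    by (simp add: annihilating_def)
qed

text \<open>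
  The variable \<open>u\<close> is the leader of the linear form \<open>P\<close>; in particular \<open>P\<close> is not zero.
\<close>

definition led_by ::
  "('n, 'm) dvar rel \<Rightarrow> ('k::field_char_0, 'n, 'm::finite) lde \<Rightarrow> ('n, 'm) dvar \<Rightarrow> bool" where
  "led_by r P u \<longleftrightarrow> u \<in> Poly_Mapping.keys P \<and> (\<forall>v\<in>Poly_Mapping.keys P. (v, u) \<in> r)"

lemma rankingD:
  assumes "ranking r"
  shows "(u, u) \<in> r" "(u, v) \<in> r \<Longrightarrow> (v, w) \<in> r \<Longrightarrow> (u, w) \<in> r"
    "(u, v) \<in> r \<Longrightarrow> (v, u) \<in> r \<Longrightarrow> u = v" "(u, v) \<in> r \<or> (v, u) \<in> r" "wf (r - Id)"
    "(u, dvar_deriv J u) \<in> r" "(u, v) \<in> r \<Longrightarrow> (dvar_deriv J u, dvar_deriv J v) \<in> r"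
proof -
  have wo: "well_order_on UNIV r" using assms by (simp add: ranking_def)
  then have lin: "linear_order_on UNIV r" and "wf (r - Id)" by (simp_all add: well_order_on_def)
  then show "wf (r - Id)" by simp
  from lin have "refl r" "trans r" "antisym r" "total r"
    by (simp_all add: linear_order_on_def partial_order_on_def preorder_on_def)
  then show "(u, u) \<in> r" "(u, v) \<in> r \<Longrightarrow> (v, w) \<in> r \<Longrightarrow> (u, w) \<in> r"
    "(u, v) \<in> r \<Longrightarrow> (v, u) \<in> r \<Longrightarrow> u = v"
    by (blast dest: transD antisymD refl_onD)+
  then show "(u, v) \<in> r \<or> (v, u) \<in> r" using \<open>total r\<close> unfolding total_on_def by (cases "u = v") blast+
  show "(u, dvar_deriv J u) \<in> r" "(u, v) \<in> r \<Longrightarrow> (dvar_deriv J u, dvar_deriv J v) \<in> r"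
    using assms unfolding ranking_def by blast+
qed

text \<open>
  Derivation shifts the leader and keeps its coefficient: the shifted leader does not occur in
  \<open>P\<close>, so no derivative of a coefficient contributes there.
\<close>

lemma led_by_pd:
  assumes r: "ranking r" and P: "led_by r P u"
  shows "led_by r (lde_pd k P) (dvar_deriv (axis k 1) u)"
proof -
  let ?a = "axis k 1 :: nat ^ 'b"
  let ?\<delta> = "dvar_deriv ?a :: ('a, 'b) dvar \<Rightarrow> _"
  have inj: "?\<delta> v = ?\<delta> w \<longleftrightarrow> v = w" for v w
    by (auto simp: dvar_deriv_def prod_eq_iff)
  have ne: "?\<delta> v \<noteq> v" for v
  proof
    assume "?\<delta> v = v"
    then have "snd v $ k + 1 = snd v $ k"
      unfolding dvar_deriv_def by (metis snd_conv vector_add_component axis_nth)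
    then show False by simp
  qed
  have le: "(v, u) \<in> r" if "v \<in> Poly_Mapping.keys P" for v
    using P that by (simp add: led_by_def)
  have u: "u \<in> Poly_Mapping.keys P" using P by (simp add: led_by_def)
  have out: "?\<delta> u \<notin> Poly_Mapping.keys P"
    using le rankingD(3)[OF r] rankingD(6)[OF r] ne by metis
  have "Poly_Mapping.lookup (lde_pd k P) (?\<delta> u) =
      (\<Sum>v\<in>Poly_Mapping.keys P. if v = u then Poly_Mapping.lookup P v else 0)"
    unfolding lde_pd_def lookup_sum lookup_add
  proof (rule sum.cong[OF refl])
    fix v assume "v \<in> Poly_Mapping.keys P"
    with out have "v \<noteq> ?\<delta> u" by metis
    then show "Poly_Mapping.lookup (Poly_Mapping.single v (mfps_pd k (Poly_Mapping.lookup P v))) (?\<delta> u) +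
        Poly_Mapping.lookup (Poly_Mapping.single (?\<delta> v) (Poly_Mapping.lookup P v)) (?\<delta> u) =
        (if v = u then Poly_Mapping.lookup P v else 0)"
      by (simp only: lookup_single when_def inj if_False add_0)
  qed
  then have "Poly_Mapping.lookup (lde_pd k P) (?\<delta> u) \<noteq> 0"
    using u by (simp add: in_keys_iff)
  moreover have "(w, ?\<delta> u) \<in> r" if "w \<in> Poly_Mapping.keys (lde_pd k P)" for w
  proof -
    have "w \<in> (\<Union>v\<in>Poly_Mapping.keys P. {v, ?\<delta> v})"
      using that unfolding lde_pd_def
      using keys_sum keys_add by (fastforce split: if_splits)
    then obtain v where "v \<in> Poly_Mapping.keys P" "w = v \<or> w = ?\<delta> v" by blast
    then show ?thesis using le rankingD(2,6,7)[OF r] by metis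
  qed
  ultimately show ?thesis by (auto simp: led_by_def in_keys_iff)
qed

lemma nat_vec_induct:
  assumes "Q (0 :: nat ^ 'm::finite)" "\<And>J k. Q J \<Longrightarrow> Q (J + axis k 1)"
  shows "Q J"
proof (induction "\<Sum>k\<in>UNIV. J $ k" arbitrary: J)
  case 0
  then have "J = 0" by (simp add: vec_eq_iff)
  with assms(1) show ?case by simp
next
  case (Suc n)
  then obtain k where k: "J $ k \<noteq> 0" by (metis sum.neutral Zero_not_Suc)
  define J' where "J' = J - axis k 1"
  have J: "J = J' + axis k 1" using k by (auto simp: J'_def vec_eq_iff axis_def)
  have "(\<Sum>k\<in>UNIV. J $ k) = (\<Sum>k\<in>UNIV. J' $ k) + (\<Sum>l\<in>UNIV. (axis k 1 :: nat ^ 'm) $ l)"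
    unfolding J by (simp add: sum.distrib)
  also have "(\<Sum>l\<in>UNIV. (axis k 1 :: nat ^ 'm) $ l) = 1" by (simp add: axis_def)
  finally have "n = (\<Sum>k\<in>UNIV. J' $ k)" using Suc(2) by simp
  from assms(2)[OF Suc(1)[OF this]] show ?case unfolding J .
qed

lemma annihilating_led_by_deriv:
  assumes r: "ranking r" and P: "P \<in> annihilating X" "led_by r P u"
  shows "\<exists>P'\<in>annihilating X. led_by r P' (dvar_deriv J u)"
proof (induction J rule: nat_vec_induct)
  case 1
  show ?case using P by (auto simp: dvar_deriv_def)
next
  case (2 J k)
  have "dvar_deriv (J + axis k 1) u = dvar_deriv (axis k 1) (dvar_deriv J u)"
    by (simp add: dvar_deriv_def add.assoc)
  with 2 led_by_pd[OF r] annihilating_pd show ?case by metis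
qed


section \<open>Partial derivatives of differential polynomials\<close>

text \<open>The monomial that consists of the variable \<open>v\<close> alone.\<close>

abbreviation var_mon :: "'v \<Rightarrow> 'v \<Rightarrow>\<^sub>0 nat" where
  "var_mon v \<equiv> Poly_Mapping.single v 1"

text \<open>
  The formal partial derivative \<open>\<partial>Q/\<partial>v\<close> of a polynomial in the variables \<open>'v\<close>, coefficientwise.
  The coefficients of \<open>Q\<close> are treated as constants.
\<close>

lift_definition poly_pd :: "'v \<Rightarrow> (('v \<Rightarrow>\<^sub>0 nat) \<Rightarrow>\<^sub>0 'a::comm_ring_1) \<Rightarrow> (('v \<Rightarrow>\<^sub>0 nat) \<Rightarrow>\<^sub>0 'a)"
  is "\<lambda>v Q \<mu>. of_nat (Poly_Mapping.lookup \<mu> v + 1) * Q (\<mu> + Poly_Mapping.single v 1)"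
proof -
  fix v and Q :: "('v \<Rightarrow>\<^sub>0 nat) \<Rightarrow> 'a"
  assume "finite {\<mu>. Q \<mu> \<noteq> 0}"
  then have "finite ((\<lambda>\<mu>. \<mu> + Poly_Mapping.single v 1) -` {\<mu>. Q \<mu> \<noteq> 0})"
    by (rule finite_vimageI) (simp add: inj_def)
  then show "finite {\<mu>. of_nat (Poly_Mapping.lookup \<mu> v + 1) * Q (\<mu> + Poly_Mapping.single v 1) \<noteq> 0}"
    by (rule rev_finite_subset) auto
qed

lemma lookup_poly_pd: "Poly_Mapping.lookup (poly_pd v Q) \<mu> =
    of_nat (Poly_Mapping.lookup \<mu> v + 1) * Poly_Mapping.lookup Q (\<mu> + var_mon v)"
  by (simp add: poly_pd.rep_eq)

lemma poly_pd_add: "poly_pd v (P + Q) = poly_pd v P + poly_pd v Q"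
  by (rule poly_mapping_eqI) (simp add: lookup_poly_pd lookup_add distrib_left)

lemma poly_pd_0: "poly_pd v 0 = 0"
  by (rule poly_mapping_eqI) (simp add: lookup_poly_pd)

lemma poly_pd_sum: "poly_pd v (sum P A) = (\<Sum>a\<in>A. poly_pd v (P a))"
  by (induction A rule: infinite_finite_induct) (simp_all add: poly_pd_add poly_pd_0)

lemma mon_diff_add: "Poly_Mapping.lookup \<mu> v \<noteq> 0 \<Longrightarrow> \<mu> - var_mon v + var_mon v = \<mu>"
  by (rule poly_mapping_eqI) (auto simp: lookup_add lookup_minus lookup_single when_def)

lemma poly_pd_single: "poly_pd v (Poly_Mapping.single \<mu> a) =
    Poly_Mapping.single (\<mu> - var_mon v) (of_nat (Poly_Mapping.lookup \<mu> v) * a)"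
proof (cases "Poly_Mapping.lookup \<mu> v = 0")
  case True
  have "\<mu> \<noteq> \<nu> + var_mon v" for \<nu>
  proof
    assume "\<mu> = \<nu> + var_mon v"
    then have "Poly_Mapping.lookup \<mu> v = Poly_Mapping.lookup \<nu> v + 1" by (simp add: lookup_add)
    with True show False by simp
  qed
  with True show ?thesis
    by (intro poly_mapping_eqI) (simp add: lookup_poly_pd lookup_single when_def)
next
  case False
  define \<mu>' where "\<mu>' = \<mu> - var_mon v"
  have \<mu>: "\<mu> = \<mu>' + var_mon v" using mon_diff_add[OF False] by (simp add: \<mu>'_def)
  have "Poly_Mapping.lookup \<mu> v = Poly_Mapping.lookup \<mu>' v + 1" unfolding \<mu> by (simp add: lookup_add)
  then show ?thesis unfolding \<mu>'_def[symmetric]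
    by (intro poly_mapping_eqI) (auto simp: lookup_poly_pd lookup_single when_def \<mu>)
qed

lemma poly_pd_mult: "poly_pd v (P * Q) = poly_pd v P * Q + P * poly_pd v Q"
proof -
  let ?S = Poly_Mapping.single and ?l = "\<lambda>\<mu>. Poly_Mapping.lookup \<mu> v"
  have mono: "poly_pd v (?S \<mu> a * ?S \<nu> b) = poly_pd v (?S \<mu> a) * ?S \<nu> b + ?S \<mu> a * poly_pd v (?S \<nu> b)"
    for \<mu> \<nu> and a b :: 'b
  proof -
    have 1: "?S (\<mu> - var_mon v + \<nu>) (of_nat (?l \<mu>) * c) = ?S (\<mu> + \<nu> - var_mon v) (of_nat (?l \<mu>) * c)"
      for \<mu> \<nu> and c :: 'b
    proof (cases "?l \<mu> = 0")
      case False
      then have "\<mu> - var_mon v + \<nu> = \<mu> + \<nu> - var_mon v"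
        by (intro poly_mapping_eqI) (auto simp: lookup_add lookup_minus lookup_single when_def)
      then show ?thesis by simp
    qed simp
    have 2: "?S (\<mu> + (\<nu> - var_mon v)) (a * (of_nat (?l \<nu>) * b)) =
        ?S (\<mu> + \<nu> - var_mon v) (of_nat (?l \<nu>) * (a * b))"
      using 1[of \<nu> \<mu> "a * b"] by (simp add: ac_simps)
    have "poly_pd v (?S \<mu> a) * ?S \<nu> b + ?S \<mu> a * poly_pd v (?S \<nu> b) =
        ?S (\<mu> - var_mon v + \<nu>) (of_nat (?l \<mu>) * (a * b)) + ?S (\<mu> + (\<nu> - var_mon v)) (a * (of_nat (?l \<nu>) * b))"
      by (simp add: poly_pd_single mult_single mult.assoc)
    also have "\<dots> = ?S (\<mu> + \<nu> - var_mon v) (of_nat (?l (\<mu> + \<nu>)) * (a * b))"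
      unfolding 1 2 by (simp add: lookup_add distrib_right flip: single_add)
    finally show ?thesis by (simp add: mult_single poly_pd_single)
  qed
  have decomp: "P = (\<Sum>\<mu>\<in>Poly_Mapping.keys P. ?S \<mu> (Poly_Mapping.lookup P \<mu>))"
    for P :: "('a \<Rightarrow>\<^sub>0 nat) \<Rightarrow>\<^sub>0 'b"
    by (rule poly_mapping_eqI) (simp add: lookup_sum lookup_single when_def in_keys_iff)
  have "poly_pd v (sum f A * sum g B) = poly_pd v (sum f A) * sum g B + sum f A * poly_pd v (sum g B)"
    if "\<And>a b. poly_pd v (f a * g b) = poly_pd v (f a) * g b + f a * poly_pd v (g b)"
    for f g :: "('a \<Rightarrow>\<^sub>0 nat) \<Rightarrow> ('a \<Rightarrow>\<^sub>0 nat) \<Rightarrow>\<^sub>0 'b" and A B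
    by (simp add: sum_product poly_pd_sum that sum.distrib)
  from this[of "\<lambda>\<mu>. ?S \<mu> (Poly_Mapping.lookup P \<mu>)" "\<lambda>\<mu>. ?S \<mu> (Poly_Mapping.lookup Q \<mu>)"
      "Poly_Mapping.keys P" "Poly_Mapping.keys Q", OF mono]
  show ?thesis unfolding decomp[symmetric] .
qed

lemma keys_poly_pdD: "\<mu> \<in> Poly_Mapping.keys (poly_pd v Q) \<Longrightarrow> \<mu> + var_mon v \<in> Poly_Mapping.keys Q"
  by (auto simp: in_keys_iff lookup_poly_pd)

lemma poly_pd_eq_0:
  assumes "v \<notin> dpoly_vars Q"
  shows "poly_pd v Q = 0"
proof (rule poly_mapping_eqI)
  fix \<mu>
  have "\<mu> + var_mon v \<notin> Poly_Mapping.keys Q"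
  proof
    assume *: "\<mu> + var_mon v \<in> Poly_Mapping.keys Q"
    have "v \<in> Poly_Mapping.keys (\<mu> + var_mon v)" by (simp add: in_keys_iff lookup_add)
    with * assms show False by (auto simp: dpoly_vars_def)
  qed
  then show "Poly_Mapping.lookup (poly_pd v Q) \<mu> = Poly_Mapping.lookup 0 \<mu>"
    by (simp add: lookup_poly_pd in_keys_iff)
qed

lemma finite_dpoly_vars: "finite (dpoly_vars Q)"
  by (simp add: dpoly_vars_def)

lemma degree_in_less_iff:
  "dpoly_degree_in v Q < n \<longleftrightarrow> 0 < n \<and> (\<forall>\<mu>\<in>Poly_Mapping.keys Q. Poly_Mapping.lookup \<mu> v < n)"
  unfolding dpoly_degree_in_def by (subst Max_less_iff) auto

lemma lookup_le_degree_in: "\<mu> \<in> Poly_Mapping.keys Q \<Longrightarrow> Poly_Mapping.lookup \<mu> v \<le> dpoly_degree_in v Q"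
  unfolding dpoly_degree_in_def by (rule Max_ge) auto

lemma dpoly_vars_poly_pd: "dpoly_vars (poly_pd v Q) \<subseteq> dpoly_vars Q"
proof
  fix w assume "w \<in> dpoly_vars (poly_pd v Q)"
  then obtain \<mu> where \<mu>: "\<mu> \<in> Poly_Mapping.keys (poly_pd v Q)" "w \<in> Poly_Mapping.keys \<mu>"
    by (auto simp: dpoly_vars_def)
  then have "w \<in> Poly_Mapping.keys (\<mu> + var_mon v)" by (simp add: in_keys_iff lookup_add)
  with keys_poly_pdD[OF \<mu>(1)] show "w \<in> dpoly_vars Q" unfolding dpoly_vars_def by blast
qed

lemma poly_pd_neq_0:
  fixes Q :: "('k::field_char_0, 'n, 'm::finite) dpoly"
  assumes "v \<in> dpoly_vars Q"
  shows "poly_pd v Q \<noteq> 0"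
proof
  assume 0: "poly_pd v Q = 0"
  obtain \<mu> where \<mu>: "\<mu> \<in> Poly_Mapping.keys Q" "Poly_Mapping.lookup \<mu> v \<noteq> 0"
    using assms by (auto simp: dpoly_vars_def in_keys_iff)
  have "Poly_Mapping.lookup (poly_pd v Q) (\<mu> - var_mon v) =
      of_nat (Suc (Poly_Mapping.lookup (\<mu> - var_mon v) v)) * Poly_Mapping.lookup Q \<mu>"
    using mon_diff_add[OF \<mu>(2)] by (simp add: lookup_poly_pd)
  then show False
    using 0 \<mu>(1) of_nat_mfps_fract_neq_0
    by (metis in_keys_iff lookup_zero mult_eq_0_iff)
qed

lemma reduced_wrt_poly_pd:
  assumes "reduced_wrt r Q Q'"
  shows "reduced_wrt r (poly_pd v Q) Q'"
  unfolding reduced_wrt_def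
proof
  show "\<forall>J. J \<noteq> 0 \<longrightarrow> dvar_deriv J (leader r Q') \<notin> dpoly_vars (poly_pd v Q)"
    using assms dpoly_vars_poly_pd[of v Q] by (auto simp: reduced_wrt_def)
  let ?u = "leader r Q'"
  have *: "dpoly_degree_in ?u Q < dpoly_degree_in ?u Q'" using assms by (simp add: reduced_wrt_def)
  show "dpoly_degree_in ?u (poly_pd v Q) < dpoly_degree_in ?u Q'"
    unfolding degree_in_less_iff
  proof (intro conjI ballI)
    show "0 < dpoly_degree_in ?u Q'" using * by simp
    fix \<mu> assume "\<mu> \<in> Poly_Mapping.keys (poly_pd v Q)"
    from lookup_le_degree_in[OF keys_poly_pdD[OF this], of ?u] *
    show "Poly_Mapping.lookup \<mu> ?u < dpoly_degree_in ?u Q'" by (simp add: lookup_add)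
  qed
qed

lemma leader_greatest:
  assumes r: "ranking r" and "dpoly_vars Q \<noteq> {}"
  shows "leader r Q \<in> dpoly_vars Q" "v \<in> dpoly_vars Q \<Longrightarrow> (v, leader r Q) \<in> r"
proof -
  have "\<exists>u\<in>V. \<forall>v\<in>V. (v, u) \<in> r" if "finite V" "V \<noteq> {}" for V
    using that
  proof (induction V rule: finite_ne_induct)
    case (singleton x)
    then show ?case using rankingD(1)[OF r] by simp
  next
    case (insert x V)
    then obtain u where u: "u \<in> V" "\<And>v. v \<in> V \<Longrightarrow> (v, u) \<in> r" by blast
    show ?case
    proof (cases "(x, u) \<in> r")
      case True
      with u show ?thesis by blast
    next
      case False
      then have "(u, x) \<in> r" using rankingD(4)[OF r] by blast
      with u have "(v, x) \<in> r" if "v \<in> V" for v using that rankingD(2)[OF r] by blast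
      then show ?thesis using rankingD(1)[OF r] by blast
    qed
  qed
  from this[OF finite_dpoly_vars assms(2)]
  obtain u where u: "u \<in> dpoly_vars Q" "\<And>v. v \<in> dpoly_vars Q \<Longrightarrow> (v, u) \<in> r" by blast
  have "leader r Q = u" unfolding leader_def
    using u rankingD(3)[OF r] by (intro the_equality) blast+
  with u show "leader r Q \<in> dpoly_vars Q" "v \<in> dpoly_vars Q \<Longrightarrow> (v, leader r Q) \<in> r" by auto
qed

text \<open>
  The separant \<open>\<partial>Q/\<partial>u\<close> of a polynomial with leader \<open>u\<close> is reduced with respect to it.
\<close>

lemma reduced_wrt_separant:
  assumes r: "ranking r" and ne: "dpoly_vars Q \<noteq> {}"
  shows "reduced_wrt r (poly_pd (leader r Q) Q) Q"
  unfolding reduced_wrt_def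
proof (intro conjI allI impI)
  let ?u = "leader r Q"
  note u = leader_greatest[OF r ne]
  fix J :: "nat ^ 'b" assume "J \<noteq> 0"
  then have "dvar_deriv J ?u \<noteq> ?u" by (auto simp: dvar_deriv_def prod_eq_iff)
  then have "dvar_deriv J ?u \<notin> dpoly_vars Q"
    using u(2) rankingD(3,6)[OF r] by metis
  then show "dvar_deriv J ?u \<notin> dpoly_vars (poly_pd ?u Q)" using dpoly_vars_poly_pd by blast
next
  let ?u = "leader r Q"
  note u = leader_greatest[OF r ne]
  show "dpoly_degree_in ?u (poly_pd ?u Q) < dpoly_degree_in ?u Q"
    unfolding degree_in_less_iff
  proof (intro conjI ballI)
    obtain \<mu> where "\<mu> \<in> Poly_Mapping.keys Q" "Poly_Mapping.lookup \<mu> ?u \<noteq> 0"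
      using u(1) by (auto simp: dpoly_vars_def in_keys_iff)
    with lookup_le_degree_in[of \<mu> Q ?u] show "0 < dpoly_degree_in ?u Q" by simp
    fix \<mu> assume "\<mu> \<in> Poly_Mapping.keys (poly_pd ?u Q)"
    from lookup_le_degree_in[OF keys_poly_pdD[OF this], of ?u]
    show "Poly_Mapping.lookup \<mu> ?u < dpoly_degree_in ?u Q" by (simp add: lookup_add)
  qed
qed

lemma module_times: "module ((*) :: 'a::comm_ring_1 \<Rightarrow> 'a \<Rightarrow> 'a)"
  by unfold_locales (simp_all add: algebra_simps)

lemma single_sum: "Poly_Mapping.single \<mu> (sum f A) = (\<Sum>a\<in>A. Poly_Mapping.single \<mu> (f a))"
  by (induction A rule: infinite_finite_induct) (simp_all add: single_add)

text \<open>
  The linear functional with values \<open>\<Phi> v\<close> on the variables kills the linear form \<open>P\<close>.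
\<close>

definition vanishes_on :: "(('n, 'm) dvar \<Rightarrow> ('k, 'm) mfps fract) \<Rightarrow>
    ('k::field_char_0, 'n, 'm::finite) lde \<Rightarrow> bool" where
  "vanishes_on \<Phi> P \<longleftrightarrow> (\<Sum>v\<in>Poly_Mapping.keys P. \<Phi> v * Fract (Poly_Mapping.lookup P v) 1) = 0"

text \<open>
  The derivation \<open>\<Sum> \<Phi>(v) \<partial>/\<partial>v\<close>, where \<open>v\<close> ranges over a finite set \<open>V\<close>. It agrees with the
  unrestricted derivation on polynomials whose variables lie in \<open>V\<close>.
\<close>

definition derivation_on ::
  "('n, 'm) dvar set \<Rightarrow> (('n, 'm) dvar \<Rightarrow> ('k, 'm) mfps fract) \<Rightarrow>
   ('k::field_char_0, 'n, 'm::finite) dpoly \<Rightarrow> ('k, 'n, 'm) dpoly" where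
  "derivation_on V \<Phi> Q = (\<Sum>v\<in>V. Poly_Mapping.single 0 (\<Phi> v) * poly_pd v Q)"

lemma derivation_on_add: "derivation_on V \<Phi> (P + Q) = derivation_on V \<Phi> P + derivation_on V \<Phi> Q"
  by (simp add: derivation_on_def poly_pd_add distrib_left sum.distrib)

lemma derivation_on_mult:
  "derivation_on V \<Phi> (P * Q) = derivation_on V \<Phi> P * Q + P * derivation_on V \<Phi> Q"
  by (simp add: derivation_on_def poly_pd_mult distrib_left sum.distrib sum_distrib_left
      sum_distrib_right ac_simps)

lemma derivation_on_dpoly_of_lde:
  assumes V: "finite V" "Poly_Mapping.keys P \<subseteq> V" and "vanishes_on \<Phi> P"
  shows "derivation_on V \<Phi> (dpoly_of_lde P) = 0"
proof -
  let ?c = "\<lambda>w. Fract (Poly_Mapping.lookup P w) 1"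
  have pd: "poly_pd v (dpoly_of_lde P) =
      (\<Sum>w\<in>Poly_Mapping.keys P. if w = v then Poly_Mapping.single 0 (?c w) else 0)" for v
    unfolding dpoly_of_lde_def poly_pd_sum poly_pd_single
    by (rule sum.cong) (auto simp: lookup_single when_def)
  have "derivation_on V \<Phi> (dpoly_of_lde P) =
      (\<Sum>v\<in>V. if v \<in> Poly_Mapping.keys P then Poly_Mapping.single 0 (\<Phi> v * ?c v) else 0)"
    unfolding derivation_on_def pd by (rule sum.cong) (simp_all add: mult_single)
  also have "\<dots> = (\<Sum>v\<in>Poly_Mapping.keys P. Poly_Mapping.single 0 (\<Phi> v * ?c v))"
    using V by (simp add: sum.If_cases Int_absorb1)
  also have "\<dots> = Poly_Mapping.single 0 (\<Sum>v\<in>Poly_Mapping.keys P. \<Phi> v * ?c v)"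
    by (simp add: single_sum)
  finally show ?thesis using assms(3) by (simp add: vanishes_on_def)
qed

text \<open>
  A derivation that kills the generators of the differential ideal maps the ideal into itself.
  The finite set \<open>V0\<close> contains the variables of the generators that occur in a representation of
  \<open>Q\<close>.
\<close>

lemma derivation_on_diff_ideal:
  assumes \<Phi>: "\<And>P. P \<in> lde_derivs \<Sigma> \<Longrightarrow> vanishes_on \<Phi> P" and "Q \<in> diff_ideal \<Sigma>"
  shows "\<exists>V0. finite V0 \<and> (\<forall>V. finite V \<longrightarrow> V0 \<subseteq> V \<longrightarrow> derivation_on V \<Phi> Q \<in> diff_ideal \<Sigma>)"
proof -
  interpret module "(*) :: ('c, 'a, 'b) dpoly \<Rightarrow> _" by (rule module_times)
  show ?thesis using assms(2) unfolding diff_ideal_def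
  proof (induction Q rule: span_induct_alt)
    case base
    have "derivation_on V \<Phi> 0 = 0" for V by (simp add: derivation_on_def poly_pd_0)
    then show ?case using span_zero by auto
  next
    case (step c x y)
    then obtain P V0 where P: "P \<in> lde_derivs \<Sigma>" "x = dpoly_of_lde P"
      and V0: "finite V0" "\<And>V. finite V \<Longrightarrow> V0 \<subseteq> V \<Longrightarrow>
        derivation_on V \<Phi> y \<in> span (dpoly_of_lde ` lde_derivs \<Sigma>)" by blast
    have "derivation_on V \<Phi> (c * x + y) \<in> span (dpoly_of_lde ` lde_derivs \<Sigma>)"
      if V: "finite V" "Poly_Mapping.keys P \<union> V0 \<subseteq> V" for V
    proof -
      have "derivation_on V \<Phi> x = 0"
        unfolding P(2) using V P(1) \<Phi> by (intro derivation_on_dpoly_of_lde) auto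
      then have "derivation_on V \<Phi> (c * x + y) = derivation_on V \<Phi> c * x + derivation_on V \<Phi> y"
        by (simp add: derivation_on_add derivation_on_mult)
      also have "\<dots> \<in> span (dpoly_of_lde ` lde_derivs \<Sigma>)"
      proof (intro span_add span_scale)
        show "x \<in> span (dpoly_of_lde ` lde_derivs \<Sigma>)" using P by (simp add: span_base)
        show "derivation_on V \<Phi> y \<in> span (dpoly_of_lde ` lde_derivs \<Sigma>)" using V V0(2) by simp
      qed
      finally show ?thesis .
    qed
    then show ?case using V0(1) by (intro exI[of _ "Poly_Mapping.keys P \<union> V0"]) auto
  qed
qed


section \<open>Leaders of characteristic sets\<close>

lemma vector_space_fun:
  "vector_space (\<lambda>c (f :: 'v \<Rightarrow> 'a::field) v. c * f v)"
  by unfold_locales (simp_all add: fun_eq_iff algebra_simps)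

lemma Fract_1_mult: "Fract (a * b) 1 = Fract a 1 * Fract b (1 :: 'a::idom)"
  by simp

lemma Fract_1_add: "Fract (a + b) 1 = Fract a 1 + Fract b (1 :: 'a::idom)"
  by simp

lemma sum_fun_apply: "(\<Sum>a\<in>A. f a) w = (\<Sum>a\<in>A. f a w)"
  by (induction A rule: infinite_finite_induct) simp_all

text \<open>
  The functional exists because \<open>u\<close> is not in the span, over the field of fractions, of the
  annihilating forms and the variables below \<open>u\<close>: clearing denominators in such a representation
  would give an annihilating form with leader \<open>u\<close>.
\<close>

lemma ex_functional:
  assumes r: "ranking r" and no: "\<And>P. P \<in> annihilating X \<Longrightarrow> \<not> led_by r P u"
  shows "\<exists>\<Phi>. (\<forall>P\<in>annihilating X. vanishes_on \<Phi> P) \<and> (\<forall>v. (v, u) \<in> r \<and> v \<noteq> u \<longrightarrow> \<Phi> v = 0) \<and> \<Phi> u = 1"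
proof -
  let ?s = "\<lambda>c (f :: ('a, 'b) dvar \<Rightarrow> ('c, 'b) mfps fract) v. c * f v"
  interpret V: vector_space ?s by (rule vector_space_fun)
  interpret F: vector_space "(*) :: ('c, 'b) mfps fract \<Rightarrow> _" by unfold_locales (simp_all add: algebra_simps)
  interpret VF: vector_space_pair ?s "(*) :: ('c, 'b) mfps fract \<Rightarrow> _" ..
  define emb where "emb P v = Fract (Poly_Mapping.lookup P v) 1" for P :: "('c, 'a, 'b) lde" and v
  define e :: "('a, 'b) dvar \<Rightarrow> ('a, 'b) dvar \<Rightarrow> ('c, 'b) mfps fract" where
    "e v w = (if w = v then 1 else 0)" for v w
  \<comment> \<open>Linear forms are viewed as coefficient functions; \<open>e v\<close> is the form \<open>v\<close>.\<close>
  define low where "low = {v. (v, u) \<in> r \<and> v \<noteq> u}"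
  define G where "G = emb ` annihilating X \<union> e ` low"
  have clear: "\<exists>b P. b \<noteq> 0 \<and> P \<in> annihilating X \<and>
      (\<forall>v. v \<notin> low \<longrightarrow> Fract b 1 * x v = Fract (Poly_Mapping.lookup P v) 1)"
    if "x \<in> V.span G" for x
    using that
  proof (induction x rule: V.span_induct_alt)
    case base
    show ?case by (rule exI[of _ 1], rule exI[of _ 0]) (simp add: annihilating_0 fract_collapse)
  next
    case (step c x y)
    then obtain b P where bP: "b \<noteq> 0" "P \<in> annihilating X"
      "\<And>v. v \<notin> low \<Longrightarrow> Fract b 1 * y v = Fract (Poly_Mapping.lookup P v) 1" by blast
    obtain p q where c: "c = Fract p q" "q \<noteq> 0" by (cases c)
    have qc: "Fract q 1 * c = Fract p 1" using c by (simp add: eq_fract)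
    have eq: "Fract (q * b) 1 * ((\<lambda>v. c * x v) + y) v
        = Fract (b * p) 1 * x v + Fract q 1 * Fract (Poly_Mapping.lookup P v) 1" if "v \<notin> low" for v
    proof -
      have "Fract (q * b) 1 * ((\<lambda>v. c * x v) + y) v =
          Fract b 1 * (Fract q 1 * c) * x v + Fract q 1 * (Fract b 1 * y v)"
        unfolding Fract_1_mult plus_fun_apply by (simp only: distrib_left ac_simps)
      then show ?thesis unfolding qc bP(3)[OF that] Fract_1_mult .
    qed
    from step(1) consider P' where "P' \<in> annihilating X" "x = emb P'" | w where "w \<in> low" "x = e w"
      unfolding G_def by blast
    then show ?case
    proof cases
      case 1
      show ?thesis
      proof (intro exI conjI allI impI)
        show "q * b \<noteq> 0" using c bP by simp
        show "lde_scale (b * p) P' + lde_scale q P \<in> annihilating X"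
          using 1 bP by (intro annihilating_add annihilating_scale)
        show "Fract (q * b) 1 * ((\<lambda>v. c * x v) + y) v =
            Fract (Poly_Mapping.lookup (lde_scale (b * p) P' + lde_scale q P) v) 1" if "v \<notin> low" for v
          by (subst eq[OF that])
            (simp only: lookup_add lookup_lde_scale Fract_1_add Fract_1_mult 1(2) emb_def)
      qed
    next
      case 2
      show ?thesis
      proof (intro exI conjI allI impI)
        show "q * b \<noteq> 0" using c bP by simp
        show "lde_scale q P \<in> annihilating X" using bP by (intro annihilating_scale)
        show "Fract (q * b) 1 * ((\<lambda>v. c * x v) + y) v =
            Fract (Poly_Mapping.lookup (lde_scale q P) v) 1" if "v \<notin> low" for v
        proof -
          have "x v = 0" using that 2 by (auto simp: e_def)
          then show ?thesis
            by (subst eq[OF that]) (simp only: lookup_lde_scale Fract_1_mult mult_zero_right add_0_left)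
        qed
      qed
    qed
  qed
  have "e u \<notin> V.span G"
  proof
    assume "e u \<in> V.span G"
    from clear[OF this] obtain b P where b: "b \<noteq> 0" and P: "P \<in> annihilating X"
      and eq: "\<And>v. v \<notin> low \<Longrightarrow> Fract b 1 * e u v = Fract (Poly_Mapping.lookup P v) 1" by blast
    have "Poly_Mapping.lookup P u \<noteq> 0"
      using eq[of u] b by (auto simp: low_def e_def eq_fract)
    moreover have "(v, u) \<in> r" if "v \<in> Poly_Mapping.keys P" for v
    proof (cases "v \<in> low \<or> v = u")
      case True
      then show ?thesis using rankingD(1)[OF r, of u] by (cases "v = u") (auto simp: low_def)
    next
      case False
      then have "Poly_Mapping.lookup P v = 0"
        using eq[of v] by (simp add: e_def Zero_fract_def eq_fract)
      with that show ?thesis by (simp add: in_keys_iff)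
    qed
    ultimately have "led_by r P u" by (auto simp: led_by_def in_keys_iff)
    with no P show False by blast
  qed
  obtain B where B: "B \<subseteq> G" "V.independent B" "G \<subseteq> V.span B"
    using V.maximal_independent_subset by blast
  have "e u \<notin> V.span B" using \<open>e u \<notin> V.span G\<close> V.span_mono[OF B(1)] by blast
  then have "V.independent (insert (e u) B)" using B(2) by (intro V.independent_insertI)
  from VF.linear_independent_extend[OF this, of "\<lambda>x. if x = e u then 1 else 0"]
  obtain g where g: "Vector_Spaces.linear ?s (*) g"
    "\<And>x. x \<in> insert (e u) B \<Longrightarrow> g x = (if x = e u then 1 else 0)" by blast
  interpret g: Vector_Spaces.linear ?s "(*)" g by (rule g(1))
  have "g x = 0" if "x \<in> B" for x
    using that g(2)[of x] V.span_base[of x B] \<open>e u \<notin> V.span B\<close> by auto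
  then have g0: "g x = 0" if "x \<in> G" for x
    using B(3) that g.eq_0_on_span[of B x] by blast
  define \<Phi> where "\<Phi> v = g (e v)" for v
  have "vanishes_on \<Phi> P" if P: "P \<in> annihilating X" for P
  proof -
    have "emb P = (\<Sum>v\<in>Poly_Mapping.keys P. ?s (Fract (Poly_Mapping.lookup P v) 1) (e v))"
    proof
      fix w
      have "(\<Sum>v\<in>Poly_Mapping.keys P. ?s (Fract (Poly_Mapping.lookup P v) 1) (e v)) w =
          (\<Sum>v\<in>Poly_Mapping.keys P. Fract (Poly_Mapping.lookup P v) 1 * e v w)"
        by (rule sum_fun_apply)
      also have "\<dots> = emb P w"
        by (simp add: e_def emb_def in_keys_iff fract_collapse if_distrib cong: if_cong)
      finally show "emb P w =
        (\<Sum>v\<in>Poly_Mapping.keys P. ?s (Fract (Poly_Mapping.lookup P v) 1) (e v)) w" ..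
    qed
    then have "g (emb P) = (\<Sum>v\<in>Poly_Mapping.keys P. Fract (Poly_Mapping.lookup P v) 1 * g (e v))"
      by (simp add: g.sum g.scale)
    moreover have "g (emb P) = 0" using P g0 by (simp add: G_def)
    ultimately show ?thesis unfolding vanishes_on_def \<Phi>_def by (simp add: mult.commute)
  qed
  moreover have "\<Phi> v = 0" if "(v, u) \<in> r" "v \<noteq> u" for v
    unfolding \<Phi>_def using that by (intro g0) (simp add: G_def low_def)
  moreover have "\<Phi> u = 1" unfolding \<Phi>_def using g(2) by simp
  ultimately show ?thesis by blast
qed

lemma characteristic_set_leader:
  assumes r: "ranking r" and cs: "characteristic_set r (diff_ideal \<Sigma>) \<Omega>" and Q: "Q \<in> \<Omega>"
  shows "\<exists>P\<in>annihilating (Sol \<Sigma>). led_by r P (leader r Q)"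
proof (rule ccontr)
  let ?u = "leader r Q"
  assume "\<not> ?thesis"
  with ex_functional[OF r, of "Sol \<Sigma>" ?u] obtain \<Phi>
    where \<Phi>: "\<And>P. P \<in> annihilating (Sol \<Sigma>) \<Longrightarrow> vanishes_on \<Phi> P"
      "\<And>v. (v, ?u) \<in> r \<Longrightarrow> v \<noteq> ?u \<Longrightarrow> \<Phi> v = 0" "\<Phi> ?u = 1" by blast
  have QI: "Q \<in> diff_ideal \<Sigma>" and ar: "autoreduced r \<Omega>" using cs Q by (auto simp: characteristic_set_def)
  have ne: "dpoly_vars Q \<noteq> {}" using ar Q by (simp add: autoreduced_def)
  note u = leader_greatest[OF r ne]
  have "vanishes_on \<Phi> P" if "P \<in> lde_derivs \<Sigma>" for P
    using \<Phi>(1) lde_derivs_annihilating[OF that] by blast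
  from derivation_on_diff_ideal[OF this QI] obtain V0 where V0: "finite V0"
    "\<And>V. finite V \<Longrightarrow> V0 \<subseteq> V \<Longrightarrow> derivation_on V \<Phi> Q \<in> diff_ideal \<Sigma>" by blast
  let ?V = "insert ?u V0"
  have "derivation_on ?V \<Phi> Q = (\<Sum>v\<in>{?u}. Poly_Mapping.single 0 (\<Phi> v) * poly_pd v Q)"
    unfolding derivation_on_def
  proof (rule sum.mono_neutral_right)
    show "\<forall>v\<in>?V - {?u}. Poly_Mapping.single 0 (\<Phi> v) * poly_pd v Q = 0"
    proof
      fix v assume v: "v \<in> ?V - {?u}"
      show "Poly_Mapping.single 0 (\<Phi> v) * poly_pd v Q = 0"
      proof (cases "v \<in> dpoly_vars Q")
        case True
        with u(2) \<Phi>(2) v have "\<Phi> v = 0" by blast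
        then show ?thesis by simp
      next
        case False
        then show ?thesis by (simp add: poly_pd_eq_0)
      qed
    qed
  qed (use V0 in auto)
  then have "derivation_on ?V \<Phi> Q = poly_pd ?u Q" by (simp add: \<Phi>(3))
  then have "poly_pd ?u Q \<in> diff_ideal \<Sigma>" using V0(2)[of ?V] V0(1) by auto
  with poly_pd_neq_0[OF u(1)] cs obtain Q' where Q': "Q' \<in> \<Omega>" "\<not> reduced_wrt r (poly_pd ?u Q) Q'"
    unfolding characteristic_set_def by blast
  show False
  proof (cases "Q' = Q")
    case True
    with Q'(2) reduced_wrt_separant[OF r ne] show False by simp
  next
    case False
    with ar Q Q'(1) have "reduced_wrt r Q Q'" by (auto simp: autoreduced_def)
    with Q'(2) reduced_wrt_poly_pd show False by blast
  qed
qed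


section \<open>The solution space is finite-dimensional\<close>

lemma homogeneous_system:
  fixes M :: "'a \<Rightarrow> 'v \<Rightarrow> 'r::idom"
  assumes "finite V" "finite A" "card V < card A"
  shows "\<exists>c. (\<exists>a\<in>A. c a \<noteq> 0) \<and> (\<forall>v\<in>V. (\<Sum>a\<in>A. c a * M a v) = 0)"
  using assms
proof (induction V arbitrary: A M)
  case empty
  then have "A \<noteq> {}" by auto
  then show ?case by (intro exI[of _ "\<lambda>_. 1"]) auto
next
  case (insert v V)
  show ?case
  proof (cases "\<forall>a\<in>A. M a v = 0")
    case True
    from insert obtain c where "\<exists>a\<in>A. c a \<noteq> 0" "\<forall>v\<in>V. (\<Sum>a\<in>A. c a * M a v) = 0"
      by (metis Suc_lessD card_insert_disjoint)
    with True show ?thesis by (intro exI[of _ c]) auto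
  next
    case False
    then obtain b where b: "b \<in> A" "M b v \<noteq> 0" by blast
    have "card V < card (A - {b})" using insert b by (simp add: card_Diff_singleton)
    \<comment> \<open>One step of elimination without division.\<close>
    from insert(3)[OF _ this, of "\<lambda>a w. M b v * M a w - M a v * M b w"] insert(4)
    obtain c where c: "\<exists>a\<in>A - {b}. c a \<noteq> 0"
      "\<And>w. w \<in> V \<Longrightarrow> (\<Sum>a\<in>A - {b}. c a * (M b v * M a w - M a v * M b w)) = 0" by auto
    define c' where "c' a = (if a = b then - (\<Sum>a\<in>A - {b}. c a * M a v) else c a * M b v)" for a
    have split: "(\<Sum>a\<in>A. c' a * M a w) =
        (\<Sum>a\<in>A - {b}. c a * M b v * M a w) - (\<Sum>a\<in>A - {b}. c a * M a v) * M b w" for w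
      using insert(4) b by (simp add: sum.remove[of A b] c'_def)
    have "(\<Sum>a\<in>A. c' a * M a w) = 0" if "w \<in> insert v V" for w
    proof (cases "w = v")
      case True
      then show ?thesis
        unfolding split by (simp add: sum_distrib_left sum_distrib_right ac_simps)
    next
      case False
      with that c(2)[of w] show ?thesis
        unfolding split by (simp add: sum_distrib_left sum_distrib_right right_diff_distrib sum_subtractf ac_simps)
    qed
    moreover have "\<exists>a\<in>A. c' a \<noteq> 0" using c(1) b by (auto simp: c'_def)
    ultimately show ?thesis by blast
  qed
qed

text \<open>
  For a monomial \<open>D\<close> of least degree in the \<open>c a\<close>, the coefficient of \<open>D\<close> in the relation only
  involves the constant terms of the jets, which are the coefficients of the \<open>\<phi> a\<close> up to nonzero
  factorials. So the coefficients of \<open>D\<close> in the \<open>c a\<close> form a relation over the constants.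
\<close>

lemma jets_dependent:
  fixes \<phi> :: "'a \<Rightarrow> ('k::field_char_0, 'm::finite) mfps ^ 'n"
  assumes "b \<in> A" "c b \<noteq> 0" and c: "\<And>v. (\<Sum>a\<in>A. c a * jet (\<phi> a) v) = 0"
  shows "\<exists>l. (\<exists>a\<in>A. l a \<noteq> 0) \<and> (\<forall>i J. (\<Sum>a\<in>A. l a * mfps_nth (\<phi> a $ i) J) = 0)"
proof -
  let ?deg = "\<lambda>J :: nat ^ 'm. \<Sum>k\<in>UNIV. J $ k"
  obtain J0 where "mfps_nth (c b) J0 \<noteq> 0" using assms(2) by (metis mfps_eqI mfps_nth_0)
  then have "\<exists>a\<in>A. mfps_nth (c a) J0 \<noteq> 0" using assms(1) by blast
  from ex_has_least_nat[of "\<lambda>J. \<exists>a\<in>A. mfps_nth (c a) J \<noteq> 0", OF this, of ?deg]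
  obtain D a0 where D: "a0 \<in> A" "mfps_nth (c a0) D \<noteq> 0"
    and min: "\<And>J. \<exists>a\<in>A. mfps_nth (c a) J \<noteq> 0 \<Longrightarrow> ?deg D \<le> ?deg J" by blast
  have "(\<Sum>a\<in>A. mfps_nth (c a) D * mfps_nth (\<phi> a $ i) J) = 0" for i J
  proof -
    let ?f = "(\<Prod>k\<in>UNIV. fact (J $ k)) :: 'k"
    have lowest: "mfps_nth (c a * g) D = mfps_nth (c a) D * mfps_nth g 0" if "a \<in> A" for a g
    proof -
      have "mfps_nth (c a * g) D = (\<Sum>p\<in>{(D, 0)}. mfps_nth (c a) (fst p) * mfps_nth g (snd p))"
        unfolding mfps_nth_times
      proof (rule sum.mono_neutral_right[OF finite_splits])
        show "\<forall>p\<in>splits D - {(D, 0)}. mfps_nth (c a) (fst p) * mfps_nth g (snd p) = 0"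
        proof
          fix p assume "p \<in> splits D - {(D, 0)}"
          then have p: "fst p + snd p = D" "p \<noteq> (D, 0)" by (auto simp: splits_def)
          then have "snd p \<noteq> 0" by (auto simp: prod_eq_iff)
          then have "?deg (snd p) \<noteq> 0" by (auto simp: vec_eq_iff)
          moreover have "?deg D = ?deg (fst p) + ?deg (snd p)"
            unfolding p(1)[symmetric] by (simp add: sum.distrib)
          ultimately have "\<not> ?deg D \<le> ?deg (fst p)" by simp
          with min that have "mfps_nth (c a) (fst p) = 0" by blast
          then show "mfps_nth (c a) (fst p) * mfps_nth g (snd p) = 0" by simp
        qed
      qed (auto simp: splits_def)
      then show ?thesis by simp
    qed
    have "0 = mfps_nth (\<Sum>a\<in>A. c a * jet (\<phi> a) (i, J)) D" by (simp add: c)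
    also have "\<dots> = (\<Sum>a\<in>A. mfps_nth (c a) D * (?f * mfps_nth (\<phi> a $ i) J))"
      unfolding mfps_nth_sum by (rule sum.cong) (simp_all add: lowest jet_def mfps_nth_Theta)
    also have "\<dots> = ?f * (\<Sum>a\<in>A. mfps_nth (c a) D * mfps_nth (\<phi> a $ i) J)"
      by (simp add: sum_distrib_left ac_simps)
    finally show ?thesis by simp
  qed
  with D show ?thesis by (intro exI[of _ "\<lambda>a. mfps_nth (c a) D"]) blast
qed

lemma Sol_dependent:
  assumes r: "ranking r" and cs: "characteristic_set r (diff_ideal \<Sigma>) \<Omega>"
    and fin: "finite (UNIV - leader_derivs r \<Omega>)"
    and A: "finite A" "card (UNIV - leader_derivs r \<Omega>) < card A"
    and \<phi>: "\<And>a. a \<in> A \<Longrightarrow> \<phi> a \<in> Sol \<Sigma>"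
  shows "\<exists>l. (\<exists>a\<in>A. l a \<noteq> 0) \<and> (\<forall>i J. (\<Sum>a\<in>A. l a * mfps_nth (\<phi> a $ i) J) = 0)"
proof -
  obtain c where c: "\<exists>a\<in>A. c a \<noteq> 0"
    "\<And>v. v \<notin> leader_derivs r \<Omega> \<Longrightarrow> (\<Sum>a\<in>A. c a * jet (\<phi> a) v) = 0"
    using homogeneous_system[OF fin A, of "\<lambda>a. jet (\<phi> a)"] by auto
  have "(\<Sum>a\<in>A. c a * jet (\<phi> a) v) = 0" for v
  proof (induction v rule: wf_induct_rule[OF rankingD(5)[OF r]])
    case (1 v)
    show ?case
    proof (cases "v \<in> leader_derivs r \<Omega>")
      case False
      then show ?thesis by (rule c(2))
    next
      case True
      then obtain J Q where "Q \<in> \<Omega>" "v = dvar_deriv J (leader r Q)" by (auto simp: leader_derivs_def)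
      with characteristic_set_leader[OF r cs] annihilating_led_by_deriv[OF r]
      obtain P where P: "P \<in> annihilating (Sol \<Sigma>)" "led_by r P v" by metis
      let ?p = "Poly_Mapping.lookup P"
      have "0 = (\<Sum>a\<in>A. c a * lde_subst P (\<phi> a))" using P(1) \<phi> by (simp add: annihilating_def)
      also have "\<dots> = (\<Sum>w\<in>Poly_Mapping.keys P. ?p w * (\<Sum>a\<in>A. c a * jet (\<phi> a) w))"
        unfolding lde_subst_jet sum_distrib_left by (subst sum.swap) (simp only: ac_simps)
      also have "\<dots> = (\<Sum>w\<in>{v}. ?p w * (\<Sum>a\<in>A. c a * jet (\<phi> a) w))"
        using P(2) 1 by (intro sum.mono_neutral_right) (auto simp: led_by_def)
      finally show ?thesis using P(2) by (simp add: led_by_def in_keys_iff)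
    qed
  qed
  with c(1) jets_dependent[of _ A c \<phi>] show ?thesis by blast
qed


section \<open>The matroid of the solution space\<close>

text \<open>
  A vector of power series as a function on \<open>[n] \<times> \<nat>\<^sup>m\<close>; its support is the image under \<open>phi\<close> of
  the vector of supports.
\<close>

definition coeffs ::
  "('k::field_char_0, 'm::finite) mfps ^ 'n \<Rightarrow> ('n, 'm) dvar \<Rightarrow> 'k" where
  "coeffs w v = mfps_nth (w $ fst v) (snd v)"

lemma Sol_0: "0 \<in> Sol (\<Sigma> :: ('k::field_char_0, 'n::finite, 'm::finite) lde set)"
proof -
  have "jet (0 :: ('k, 'm) mfps ^ 'n) v = 0" for v
    by (rule mfps_eqI) (simp add: jet_def mfps_nth_Theta)
  then show ?thesis by (simp add: Sol_def lde_subst_jet)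
qed

lemma Sol_comb:
  assumes "w \<in> Sol \<Sigma>" "w' \<in> Sol \<Sigma>"
  shows "(\<chi> i. w $ i + mfps_const c * w' $ i) \<in> Sol \<Sigma>"
proof -
  have "jet (\<chi> i. w $ i + mfps_const c * w' $ i) v = jet w v + mfps_const c * jet w' v" for v
    by (simp add: jet_def Theta_add Theta_const_mult)
  then have "lde_subst P (\<chi> i. w $ i + mfps_const c * w' $ i) =
      lde_subst P w + mfps_const c * lde_subst P w'" for P
    by (simp add: lde_subst_jet distrib_left sum.distrib sum_distrib_left ac_simps)
  with assms show ?thesis by (simp add: Sol_def)
qed

lemma findim_Sol:
  fixes \<Sigma> :: "('k::field_char_0, 'n::finite, 'm::finite) lde set"
  assumes "differential_type_zero \<Sigma>"
  shows "\<exists>d. findim_function_space (coeffs ` Sol \<Sigma>) d"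
proof -
  obtain r \<Omega> where r: "ranking r" "characteristic_set r (diff_ideal \<Sigma>) \<Omega>"
    "finite (UNIV - leader_derivs r \<Omega>)"
    using assms unfolding differential_type_zero_def by blast
  define d where "d = card (UNIV - leader_derivs r \<Omega>)"
  have "findim_function_space (coeffs ` Sol \<Sigma>) d"
  proof
    have "coeffs (0 :: ('k, 'm) mfps ^ 'n) = (\<lambda>_. 0)" by (simp add: coeffs_def fun_eq_iff)
    then show "(\<lambda>_. 0) \<in> coeffs ` Sol \<Sigma>" 
      by (rule image_eqI[OF sym]) (rule Sol_0)
  next
    fix f g and c :: 'k assume "f \<in> coeffs ` Sol \<Sigma>" "g \<in> coeffs ` Sol \<Sigma>"
    then obtain w w' where w: "w \<in> Sol \<Sigma>" "w' \<in> Sol \<Sigma>" "f = coeffs w" "g = coeffs w'" by blast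
    have "coeffs (\<chi> i. w $ i + mfps_const c * w' $ i) = (\<lambda>e. f e + c * g e)"
      by (simp add: coeffs_def fun_eq_iff w mfps_nth_const_mult)
    then show "(\<lambda>e. f e + c * g e) \<in> coeffs ` Sol \<Sigma>" 
      by (rule image_eqI[OF sym]) (rule Sol_comb[OF w(1,2)])
  next
    fix F :: "nat \<Rightarrow> ('n, 'm) dvar \<Rightarrow> 'k" assume F: "\<And>i. i \<le> d \<Longrightarrow> F i \<in> coeffs ` Sol \<Sigma>"
    have "\<forall>i\<in>{..d}. \<exists>w. w \<in> Sol \<Sigma> \<and> F i = coeffs w"
    proof
      fix i assume "i \<in> {..d}"
      then have "F i \<in> coeffs ` Sol \<Sigma>" by (intro F) simp
      then show "\<exists>w. w \<in> Sol \<Sigma> \<and> F i = coeffs w" by (elim imageE) (intro exI conjI)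
    qed
    from bchoice[OF this] obtain w
      where w: "\<forall>i\<in>{..d}. w i \<in> Sol \<Sigma> \<and> F i = coeffs (w i)" ..
    have "card (UNIV - leader_derivs r \<Omega>) < card {..d}" by (simp add: d_def)
    from Sol_dependent[OF r finite_atMost this, of w] w
    obtain c where c: "\<exists>i\<in>{..d}. c i \<noteq> 0"
      "\<And>i J. (\<Sum>a\<le>d. c a * mfps_nth (w a $ i) J) = 0" by blast
    have "(\<Sum>i\<le>d. c i * F i e) = 0" for e
      using c(2)[of "fst e" "snd e"] w by (simp add: coeffs_def)
    with c(1) show "\<exists>c. (\<exists>i\<le>d. c i \<noteq> 0) \<and> (\<forall>e. (\<Sum>i\<le>d. c i * F i e) = 0)" by auto
  qed
  then show ?thesis ..
qed

lemma phi_subset_iff: "phi S \<subseteq> phi T \<longleftrightarrow> S \<le> T"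
  by (auto simp: phi_def less_eq_vec_def)

lemma phi_eq_iff: "phi S = phi T \<longleftrightarrow> S = T"
  by (simp add: set_eq_subset phi_subset_iff order_eq_iff)

lemma phi_empty_iff: "phi S = {} \<longleftrightarrow> S = (\<chi> i. {})"
  by (auto simp: phi_def vec_eq_iff)

lemma phi_supports:
  fixes X :: "(('k::field_char_0, 'm::finite) mfps ^ 'n::finite) set"
  shows "phi ` supports X = fsupp ` coeffs ` X"
proof -
  have "phi (\<chi> i. supp (w $ i)) = fsupp (coeffs w)" for w :: "('k, 'm) mfps ^ 'n"
    by (auto simp: phi_def supp_def fsupp_def coeffs_def)
  then show ?thesis by (simp add: supports_def image_image)
qed

lemma phi_min_supports:
  assumes "findim_function_space (coeffs ` X) d"
  shows "phi ` min_supports X = findim_function_space.circuits (coeffs ` X)"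
proof -
  interpret findim_function_space "coeffs ` X" d by (rule assms)
  have "S \<in> min_supports X \<longleftrightarrow> S \<in> supports X \<and> phi S \<noteq> {} \<and>
      (\<forall>C'\<in>phi ` supports X. C' \<noteq> {} \<longrightarrow> C' \<subseteq> phi S \<longrightarrow> C' = phi S)" for S
    unfolding min_supports_def by (simp add: phi_subset_iff phi_eq_iff phi_empty_iff)
  then have "phi ` min_supports X = {C \<in> phi ` supports X. C \<noteq> {} \<and>
      (\<forall>C'\<in>phi ` supports X. C' \<noteq> {} \<longrightarrow> C' \<subseteq> C \<longrightarrow> C' = C)}" by blast
  then show ?thesis by (simp add: circuits_def phi_supports)
qed

theorem theorem1p1:
  fixes \<Sigma> :: "('k::field_char_0, 'n::finite, 'm::finite) lde set"
  assumes "differential_type_zero \<Sigma>"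
  shows "matroid_circuits (UNIV :: ('n \<times> (nat ^ 'm)) set) (phi ` min_supports (Sol \<Sigma>)) \<and>
    ((UNIV :: ('n \<times> (nat ^ 'm)) set) \<prec> (UNIV :: 'k set) \<longrightarrow>
       phi ` supports (Sol \<Sigma>) = scrawls (phi ` min_supports (Sol \<Sigma>)))"
proof -
  obtain d where d: "findim_function_space (coeffs ` Sol \<Sigma>) d" using findim_Sol[OF assms] ..
  interpret findim_function_space "coeffs ` Sol \<Sigma>" d by (rule d)
  show ?thesis
    unfolding phi_min_supports[OF d] phi_supports
    using matroid_circuits_circuits supports_eq_scrawls by blast
qed

end
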